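(* Let $d\geq 1$ be an integer, let $(X,\mathcal{B},\mu)$ be a probability space and let $T_1,\dots,T_d$ be commuting invertible measure preserving transformations of $(X,\mathcal B,\mu)$. Let $f_{\epsilon}$, $\epsilon\in\{0,1\}^d\setminus\{00\cdots0\}$, be $2^d-1$ bounded measurable functions on $X$. Then the averages $$\prod_{i=1}^d \frac{1}{N_i-M_i}\ \sum_{\substack{n_i\in[M_i, N_i)\\ i=1,\dots,d}}\ \prod_{\substack{\epsilon\in \{0,1\}^d\\ \epsilon\neq 00\cdots0}}T_1^{n_1 \epsilon_1}\cdots T_d^{n_d\epsilon_d}f_{\epsilon}$$ converge in $L^{2}(\mu)$ for all sequences of intervals $[M_1,N_1),\dots,[M_d,N_d)$ whose lengths $N_i-M_i$ ($1\leq i\leq d$) tend to $\infty$.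
   Context: For a transformation $S$ of $X$ and a function $f$ on $X$, $Sf$ denotes $f\circ S$. Here $\epsilon=\epsilon_1\cdots\epsilon_d$ with $\epsilon_i\in\{0,1\}$. The intervals are intervals of integers: $[M_i,N_i)=\{n\in\mathbb Z: M_i\le n<N_i\}$ with $M_i<N_i$ integers. "For all sequences of intervals" means: for each $i=1,\dots,d$ one is given a sequence of intervals $([M_{i,k},N_{i,k}))_{k\ge 1}$ with $N_{i,k}-M_{i,k}\to\infty$ as $k\to\infty$, and the averages taken over $[M_{1,k},N_{1,k})\times\cdots\times[M_{d,k},N_{d,k})$ converge as $k\to\infty$. *)

theory Defs
  imports "HOL-Probability.Probability"
begin

definition invertible_mpt :: "'a measure \<Rightarrow> ('a \<Rightarrow> 'a) \<Rightarrow> bool" where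
  "invertible_mpt M T \<longleftrightarrow>
     bij_betw T (space M) (space M) \<and>
     T \<in> measurable M M \<and>
     inv_into (space M) T \<in> measurable M M \<and>
     distr M M T = M"

(* The inverse is taken in the space of M, since T need not be injective on the whole type. *)
definition int_iterate :: "'a measure \<Rightarrow> ('a \<Rightarrow> 'a) \<Rightarrow> int \<Rightarrow> 'a \<Rightarrow> 'a" where
  "int_iterate M T n =
     (if n \<ge> 0 then T ^^ nat n else inv_into (space M) T ^^ nat (- n))"

(* T_1^(m_1) o ... o T_d^(m_d) *)
definition joint_iterate ::
    "'a measure \<Rightarrow> nat \<Rightarrow> (nat \<Rightarrow> 'a \<Rightarrow> 'a) \<Rightarrow> (nat \<Rightarrow> int) \<Rightarrow> 'a \<Rightarrow> 'a" where
  "joint_iterate M d T m =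
     foldr (\<lambda>i S. int_iterate M (T i) (m i) \<circ> S) [1..<Suc d] id"

(* {0,1}^d without the point 00...0; by the definition of PiE, points are functions
   that are undefined outside {1..d}. *)
definition nonzero_vertices :: "nat \<Rightarrow> (nat \<Rightarrow> int) set" where
  "nonzero_vertices d = ({1..d} \<rightarrow>\<^sub>E {0, 1}) - {\<lambda>i\<in>{1..d}. 0}"

definition cubic_average ::
    "'a measure \<Rightarrow> nat \<Rightarrow> (nat \<Rightarrow> 'a \<Rightarrow> 'a) \<Rightarrow> ((nat \<Rightarrow> int) \<Rightarrow> 'a \<Rightarrow> complex) \<Rightarrow>
     (nat \<Rightarrow> int) \<Rightarrow> (nat \<Rightarrow> int) \<Rightarrow> 'a \<Rightarrow> complex" where
  "cubic_average M d T f a b x =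
     (\<Prod>i=1..d. 1 / of_int (b i - a i)) *
     (\<Sum>n\<in>(\<Pi>\<^sub>E i\<in>{1..d}. {a i..<b i}).
        \<Prod>\<epsilon>\<in>nonzero_vertices d. f \<epsilon> (joint_iterate M d T (\<lambda>i. n i * \<epsilon> i) x))"

definition L2 :: "'a measure \<Rightarrow> ('a \<Rightarrow> complex) set" where
  "L2 M = {g \<in> borel_measurable M. integrable M (\<lambda>x. (norm (g x))\<^sup>2)}"

definition convergent_in_L2 :: "'a measure \<Rightarrow> (nat \<Rightarrow> 'a \<Rightarrow> complex) \<Rightarrow> bool" where
  "convergent_in_L2 M A \<longleftrightarrow>
     (\<forall>k. A k \<in> L2 M) \<and>
     (\<exists>F\<in>L2 M. (\<lambda>k. sqrt (\<integral>x. (norm (A k x - F x))\<^sup>2 \<partial>M)) \<longlonglongrightarrow> 0)"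

end

theory Submission
  imports Defs "HOL-Library.Function_Algebras"
begin

text \<open>
  A vertex \<open>\<epsilon>\<close> of the cube is identified with the set \<open>\<beta>\<close> of its coordinates equal to 1, and \<open>n\<^sub>\<beta>\<close>
  (below \<open>restr \<beta> n\<close>) denotes \<open>n\<close> with the coordinates outside \<open>\<beta>\<close> set to 0. The averages are then
  the means over \<open>n\<close> in a box of the products \<open>\<Prod>\<beta>\<in>E. f\<^sub>\<beta>(T\<^bsup>n\<^sub>\<beta>\<^esup> x)\<close>. Since they are uniformly bounded,
  it suffices to show that they form a Cauchy sequence for the square norm
  (\<open>convergent_in_L2_Cauchy\<close>). This is proved for every finite family \<open>E\<close> of index sets that is
  closed under intersection and contains the empty set, by removing a maximal element \<open>\<alpha>\<close> from \<open>E\<close>.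

  With the other functions fixed, the average is linear in \<open>g = f\<^sub>\<alpha>\<close> and its square norm is controlled
  by that of \<open>g\<close>. The functions \<open>g\<close> that satisfy an identity
  \<open>g(T\<^bsup>n\<^sub>\<alpha>\<^esup> x) = H(x) \<Prod>\<beta>\<in>E - {\<alpha>}. D\<^sub>\<beta>(T\<^bsup>n\<^sub>\<beta>\<^sub>\<inter>\<^sub>\<alpha>\<^esup> x)\<close> are harmless: the factors \<open>D\<^sub>\<beta>\<close> and \<open>H\<close> are
  absorbed by the functions at the vertices \<open>\<beta> \<inter> \<alpha>\<close> and \<open>{}\<close>, and an average over \<open>E - {\<alpha>}\<close>
  remains (\<open>cube_avg_dual\<close>). On the other hand, let \<open>h\<^sub>k\<close> be the average with \<open>w\<close> at the vertex
  \<open>\<alpha>\<close>, and suppose that it does not tend to 0. Expanding the square norm of \<open>h\<^sub>k\<close> and translating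
  by \<open>-n\<^sub>\<alpha>\<close> shows that \<open>w\<close> has a correlation bounded away from 0 with the mean over \<open>n\<close> of the
  functions
  \<open>G\<^sub>k\<^sub>,\<^sub>n(x) = h\<^sub>k(T\<^bsup>-n\<^sub>\<alpha>\<^esup> x) \<Prod>\<beta>\<in>E - {\<alpha>}. cnj (f\<^sub>\<beta>(T\<^bsup>n\<^sub>\<beta> - n\<^sub>\<alpha>\<^esup> x))\<close>.

  The point is to treat \<open>k\<close> and \<open>n\<close> as new coordinates. On triples \<open>(k, n, x)\<close> let \<open>T\<^bsup>m\<^esup>\<close> act by
  \<open>(k, n, x) \<mapsto> (k, n + m, T\<^bsup>m\<^esup> x)\<close>, and let the measure be a generalized limit over \<open>k\<close> of the uniform
  measures on the boxes; it is invariant because the boxes become invariant under translations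
  (\<open>extension_state\<close>). In this extension \<open>G\<close> is a single function that satisfies the identity of
  the preceding paragraph exactly. Hence, if the averages with \<open>f\<^sub>\<alpha>\<close> are not Cauchy and \<open>g\<close> is a
  function with Cauchy averages, adding a small multiple of \<open>G\<close> for \<open>w = f\<^sub>\<alpha> - g\<close> to \<open>g\<close> produces,
  in an extension, a function that still has Cauchy averages and whose squared distance to \<open>f\<^sub>\<alpha>\<close> is
  smaller by a fixed amount (\<open>decrease_distance\<close>). Repetition leads to a negative squared distance.

  A generalized limit of measures is only finitely additive. The argument is therefore carried out for
  positive functionals on an algebra of bounded functions, where neither completeness nor
  \<open>\<sigma>\<close>-additivity is available. To let an induction range over repeated extensions, all of them live on
  one type: a point of the underlying space together with a list of the adjoined pairs \<open>(k, n)\<close>, the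
  extension step being the passage from a list to a longer one.
\<close>

section \<open>Generalized limits of bounded sequences\<close>

lemma Bseq_plus:
  fixes x y :: "nat \<Rightarrow> real"
  assumes "Bseq x" "Bseq y"
  shows "Bseq (\<lambda>k. x k + y k)"
proof -
  obtain K L where "\<And>k. norm (x k) \<le> K" "\<And>k. norm (y k) \<le> L"
    using assms by (metis Bseq_def)
  then have "norm (x k + y k) \<le> K + L" for k
    by (meson add_mono norm_triangle_le)
  then show ?thesis
    by (rule BseqI')
qed

text \<open>
  The functional is a cluster point of the evaluations \<open>x \<mapsto> x k\<close>: on bounded sequences these range in a
  product of compact intervals, so Tychonoff's theorem provides one. Linearity and bounds are
  closed conditions on finitely many coordinates, hence survive in the limit.
\<close>

lemma generalized_limit_exists:
  "\<exists>L :: (nat \<Rightarrow> real) \<Rightarrow> real.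
     (\<forall>x y. Bseq x \<longrightarrow> Bseq y \<longrightarrow> L (\<lambda>k. x k + y k) = L x + L y) \<and>
     (\<forall>x c. Bseq x \<longrightarrow> L (\<lambda>k. c * x k) = c * L x) \<and>
     (\<forall>x c. Bseq x \<longrightarrow> (\<forall>\<^sub>F k in sequentially. c \<le> x k) \<longrightarrow> c \<le> L x)"
proof -
  define B where "B x = (SOME K. 0 \<le> K \<and> (\<forall>k. \<bar>x k\<bar> \<le> K))" for x :: "nat \<Rightarrow> real"
  have B: "0 \<le> B x \<and> (\<forall>k. \<bar>x k\<bar> \<le> B x)" if x: "Bseq x" for x
  proof -
    obtain K where "K > 0" "\<And>k. \<bar>x k\<bar> \<le> K"
      using x by (auto simp: Bseq_def)
    then show ?thesis
      unfolding B_def by (intro someI[of "\<lambda>K. 0 \<le> K \<and> (\<forall>k. \<bar>x k\<bar> \<le> K)" K]) auto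
  qed
  define C where "C x = (if Bseq x then {- B x..B x} else {0})" for x
  define \<phi> where "\<phi> k x = (if Bseq x then x k else 0)" for k and x :: "nat \<Rightarrow> real"
  have "compactin (product_topology (\<lambda>x. euclidean) UNIV) (PiE UNIV C)"
    by (subst compactin_PiE) (auto simp: C_def)
  then have "compact (PiE UNIV C)"
    by (simp add: euclidean_product_topology)
  moreover have "\<forall>\<^sub>F \<psi> in filtermap \<phi> sequentially. \<psi> \<in> PiE UNIV C"
    unfolding eventually_filtermap using B
    by (intro always_eventually) (auto simp: C_def \<phi>_def abs_le_iff, metis minus_le_iff)
  moreover have "filtermap \<phi> sequentially \<noteq> bot"
    by (simp add: filtermap_bot_iff)
  ultimately obtain L where L: "inf (nhds L) (filtermap \<phi> sequentially) \<noteq> bot"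
    unfolding compact_filter by metis
  \<comment> \<open>A closed condition that eventually holds along \<phi> passes to the cluster point.\<close>
  have transfer: "\<Psi> L \<ge> 0"
    if cont: "continuous_on UNIV \<Psi>" and ev: "\<forall>\<^sub>F k in sequentially. \<Psi> (\<phi> k) \<ge> 0"
    for \<Psi> :: "((nat \<Rightarrow> real) \<Rightarrow> real) \<Rightarrow> real"
  proof (rule ccontr)
    assume neg: "\<not> \<Psi> L \<ge> 0"
    have "open {\<psi>. \<Psi> \<psi> < 0}"
      by (intro open_Collect_less cont continuous_on_const)
    then have "\<forall>\<^sub>F \<psi> in nhds L. \<Psi> \<psi> < 0"
      using neg eventually_nhds_in_open by fastforce
    moreover have "\<forall>\<^sub>F \<psi> in filtermap \<phi> sequentially. \<Psi> \<psi> \<ge> 0"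
      using ev by (simp add: eventually_filtermap)
    ultimately have "eventually (\<lambda>_. False) (inf (nhds L) (filtermap \<phi> sequentially))"
      unfolding eventually_inf by (metis linorder_not_le)
    with L show False
      by (simp add: trivial_limit_def)
  qed
  have ev: "continuous_on UNIV (\<lambda>\<psi> :: (nat \<Rightarrow> real) \<Rightarrow> real. \<psi> x)" for x
    by (intro continuous_on_product_coordinates)
  have eq: "\<Psi> L = 0"
    if "continuous_on UNIV \<Psi>" and "\<And>k. \<Psi> (\<phi> k) = 0" for \<Psi> :: "((nat \<Rightarrow> real) \<Rightarrow> real) \<Rightarrow> real"
    using transfer[of \<Psi>] transfer[of "\<lambda>\<psi>. - \<Psi> \<psi>"] that
    by (auto intro: continuous_on_minus)
  show ?thesis
  proof (intro exI[of _ L] conjI allI impI)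
    fix x y :: "nat \<Rightarrow> real" assume "Bseq x" "Bseq y"
    moreover have "continuous_on UNIV (\<lambda>\<psi> :: (nat \<Rightarrow> real) \<Rightarrow> real. \<psi> (\<lambda>k. x k + y k) - (\<psi> x + \<psi> y))"
      by (intro continuous_on_diff continuous_on_add continuous_on_mult continuous_on_const ev)
    ultimately show "L (\<lambda>k. x k + y k) = L x + L y"
      using eq[of "\<lambda>\<psi>. \<psi> (\<lambda>k. x k + y k) - (\<psi> x + \<psi> y)"] by (simp add: \<phi>_def Bseq_plus)
  next
    fix x :: "nat \<Rightarrow> real" and c assume "Bseq x"
    moreover from this have "Bseq (\<lambda>k. c * x k)"
      using Bseq_mult[of "\<lambda>_. c" x] by simp
    moreover have "continuous_on UNIV (\<lambda>\<psi> :: (nat \<Rightarrow> real) \<Rightarrow> real. \<psi> (\<lambda>k. c * x k) - c * \<psi> x)"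
      by (intro continuous_on_diff continuous_on_add continuous_on_mult continuous_on_const ev)
    ultimately show "L (\<lambda>k. c * x k) = c * L x"
      using eq[of "\<lambda>\<psi>. \<psi> (\<lambda>k. c * x k) - c * \<psi> x"] by (simp add: \<phi>_def)
  next
    fix x :: "nat \<Rightarrow> real" and c assume "Bseq x" "\<forall>\<^sub>F k in sequentially. c \<le> x k"
    moreover have "continuous_on UNIV (\<lambda>\<psi> :: (nat \<Rightarrow> real) \<Rightarrow> real. \<psi> x - c)"
      by (intro continuous_on_diff continuous_on_add continuous_on_mult continuous_on_const ev)
    ultimately show "c \<le> L x"
      using transfer[of "\<lambda>\<psi>. \<psi> x - c"] by (simp add: \<phi>_def)
  qed
qed

definition glim :: "(nat \<Rightarrow> real) \<Rightarrow> real" where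
  "glim = (SOME L.
     (\<forall>x y. Bseq x \<longrightarrow> Bseq y \<longrightarrow> L (\<lambda>k. x k + y k) = L x + L y) \<and>
     (\<forall>x c. Bseq x \<longrightarrow> L (\<lambda>k. c * x k) = c * L x) \<and>
     (\<forall>x c. Bseq x \<longrightarrow> (\<forall>\<^sub>F k in sequentially. c \<le> x k) \<longrightarrow> c \<le> L x))"

lemma glim_add: "Bseq x \<Longrightarrow> Bseq y \<Longrightarrow> glim (\<lambda>k. x k + y k) = glim x + glim y"
  and glim_mult: "Bseq x \<Longrightarrow> glim (\<lambda>k. c * x k) = c * glim x"
  and glim_ge: "Bseq x \<Longrightarrow> \<forall>\<^sub>F k in sequentially. c \<le> x k \<Longrightarrow> c \<le> glim x"
  using someI_ex[OF generalized_limit_exists] unfolding glim_def[symmetric] by blast+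

lemma glim_le:
  assumes "Bseq x" "\<forall>\<^sub>F k in sequentially. x k \<le> c"
  shows "glim x \<le> c"
  using glim_ge[of "\<lambda>k. - x k" "- c"] glim_mult[OF assms(1), of "-1"] assms
  by (simp add: Bseq_minus_iff)

text \<open>
  The generalized limit only sees the tail of a sequence. This is what makes limits of asymptotically
  invariant functionals invariant.
\<close>

lemma glim_eq_lim:
  assumes "x \<longlonglongrightarrow> l"
  shows "glim x = l"
proof (rule antisym)
  have b: "Bseq x"
    using assms by (simp add: convergentI convergent_imp_Bseq)
  show "glim x \<le> l"
  proof (rule field_le_epsilon)
    fix e :: real assume "e > 0"
    then have "\<forall>\<^sub>F k in sequentially. x k < l + e"
      using order_tendstoD(2)[OF assms] by simp
    then show "glim x \<le> l + e"
      using glim_le[OF b] by (metis (mono_tags, lifting) eventually_mono less_imp_le)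
  qed
  show "l \<le> glim x"
  proof (rule field_le_epsilon)
    fix e :: real assume "e > 0"
    then have "\<forall>\<^sub>F k in sequentially. l - e < x k"
      using order_tendstoD(1)[OF assms] by simp
    then have "l - e \<le> glim x"
      using glim_ge[OF b] by (metis (mono_tags, lifting) eventually_mono less_imp_le)
    then show "l \<le> glim x + e"
      by simp
  qed
qed

lemma glim_const: "glim (\<lambda>_. c) = c"
  by (simp add: glim_eq_lim)

section \<open>Invariant states on an algebra of bounded functions\<close>

definition restr :: "'i set \<Rightarrow> ('i \<Rightarrow> int) \<Rightarrow> 'i \<Rightarrow> int" where
  "restr S m = (\<lambda>i. if i \<in> S then m i else 0)"

lemma restr_empty: "restr {} m = 0"
  by (auto simp: restr_def fun_eq_iff)

text \<open>
  The type \<open>'y\<close> is large enough to contain all iterated extensions of a system: it contains a copy of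
  itself for every pair \<open>(j, n)\<close>, embedded by \<open>copy j n\<close>. A function on \<open>'y\<close> thus encodes a family of
  functions indexed by \<open>(j, n)\<close>, and by the gluing axiom every uniformly bounded family in \<open>A\<close> arises in
  this way. The action moves the copies among each other by translating \<open>n\<close>. Asymptotic invariance of the sets
  \<open>B k\<close> is asked for translations supported in \<open>I\<close> only, since the boxes are degenerate in all other
  directions.
\<close>

locale copy_system =
  fixes I :: "'i set"
    and act :: "('i \<Rightarrow> int) \<Rightarrow> 'y \<Rightarrow> 'y"
    and A :: "('y \<Rightarrow> complex) set"
    and copy :: "nat \<Rightarrow> ('i \<Rightarrow> int) \<Rightarrow> 'y \<Rightarrow> 'y"
    and B :: "nat \<Rightarrow> ('i \<Rightarrow> int) set"
  assumes act_zero: "act 0 y = y"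
    and act_add: "act (m + n) y = act m (act n y)"
    and A_bounded: "F \<in> A \<Longrightarrow> \<exists>K. \<forall>y. norm (F y) \<le> K"
    and A_const: "(\<lambda>_. c) \<in> A"
    and A_add: "F \<in> A \<Longrightarrow> G \<in> A \<Longrightarrow> (\<lambda>y. F y + G y) \<in> A"
    and A_mult: "F \<in> A \<Longrightarrow> G \<in> A \<Longrightarrow> (\<lambda>y. F y * G y) \<in> A"
    and A_cnj: "F \<in> A \<Longrightarrow> (\<lambda>y. cnj (F y)) \<in> A"
    and A_act: "F \<in> A \<Longrightarrow> (\<lambda>y. F (act m y)) \<in> A"
    and A_copy: "F \<in> A \<Longrightarrow> (\<lambda>y. F (copy j n y)) \<in> A"
    and A_glue: "(\<And>j n. \<Phi> j n \<in> A) \<Longrightarrow> (\<And>j n y. norm (\<Phi> j n y) \<le> K) \<Longrightarrow>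
      \<exists>F\<in>A. (\<forall>y. norm (F y) \<le> K) \<and> (\<forall>j n y. F (copy j n y) = \<Phi> j n y)"
    and act_copy: "act m (copy j n y) = copy j (n + m) (act m y)"
    and B_finite: "finite (B k)"
    and B_nonempty: "B k \<noteq> {}"
    and Folner: "(\<And>i. i \<notin> I \<Longrightarrow> m i = 0) \<Longrightarrow>
      (\<lambda>k. card ((\<lambda>n. n + m) ` B k - B k) / card (B k)) \<longlonglongrightarrow> 0"
begin

lemma card_B_pos: "0 < real (card (B k))"
  using B_finite B_nonempty by (simp add: card_gt_0_iff)

definition mean :: "nat \<Rightarrow> (('i \<Rightarrow> int) \<Rightarrow> 'v :: real_vector) \<Rightarrow> 'v" where
  "mean k \<phi> = (1 / card (B k)) *\<^sub>R (\<Sum>n\<in>B k. \<phi> n)"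

lemma mean_add: "mean k (\<lambda>n. \<phi> n + \<psi> n) = mean k \<phi> + mean k \<psi>"
  by (simp add: mean_def sum.distrib scaleR_add_right)

lemma mean_diff: "mean k (\<lambda>n. \<phi> n - \<psi> n) = mean k \<phi> - mean k \<psi>"
  by (simp add: mean_def sum_subtractf scaleR_diff_right)

lemma mean_scale: "mean k (\<lambda>n. c * \<phi> n) = c * mean k \<phi>" for \<phi> :: "_ \<Rightarrow> real"
  by (simp add: mean_def flip: sum_distrib_left)

lemma mean_mult_right: "mean k (\<lambda>n. \<phi> n * c) = mean k \<phi> * c" for \<phi> :: "_ \<Rightarrow> 'v :: real_algebra"
  by (simp add: mean_def sum_distrib_right)

lemma mean_const: "mean k (\<lambda>_. c) = c"
  using card_B_pos[of k] by (simp add: mean_def sum_constant_scaleR)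

lemma mean_mono: "(\<And>n. \<phi> n \<le> \<psi> n) \<Longrightarrow> mean k \<phi> \<le> mean k \<psi>" for \<phi> \<psi> :: "_ \<Rightarrow> real"
  by (simp add: mean_def sum_mono divide_right_mono)

lemma mean_le: "(\<And>n. \<phi> n \<le> c) \<Longrightarrow> mean k \<phi> \<le> c" for \<phi> :: "_ \<Rightarrow> real"
  using mean_mono[of \<phi> "\<lambda>_. c" k] by (simp add: mean_const)

lemma mean_ge: "(\<And>n. c \<le> \<phi> n) \<Longrightarrow> c \<le> mean k \<phi>" for \<phi> :: "_ \<Rightarrow> real"
  using mean_mono[of "\<lambda>_. c" \<phi> k] by (simp add: mean_const)

lemma norm_mean_le:
  fixes \<phi> :: "_ \<Rightarrow> 'v :: real_normed_vector"
  assumes "\<And>n. norm (\<phi> n) \<le> c"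
  shows "norm (mean k \<phi>) \<le> c"
  using sum_norm_bound[of "B k" \<phi> c] assms card_B_pos[of k]
  by (simp add: mean_def divide_le_eq mult.commute)

lemma norm_mean_square:
  fixes \<phi> :: "_ \<Rightarrow> complex"
  shows "(norm (mean k \<phi>))\<^sup>2 \<le> mean k (\<lambda>n. (norm (\<phi> n))\<^sup>2)"
proof -
  have "(norm (\<Sum>n\<in>B k. \<phi> n))\<^sup>2 \<le> (\<Sum>n\<in>B k. norm (\<phi> n))\<^sup>2"
    by (intro power_mono norm_sum) auto
  also have "\<dots> \<le> (\<Sum>n\<in>B k. (norm (\<phi> n))\<^sup>2) * card (B k)"
    by (rule sum_squared_le_sum_of_squares)
  finally show ?thesis
    using card_B_pos[of k]
    by (simp add: mean_def power_divide power2_eq_square field_simps)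
qed

text \<open>
  Translation changes the sum over \<open>B k\<close> only on the two halves of the symmetric difference of \<open>B k\<close>
  and its translate, which have equal cardinality.
\<close>

lemma mean_shift:
  fixes \<psi> :: "_ \<Rightarrow> real"
  assumes "\<And>n. \<bar>\<psi> n\<bar> \<le> K"
  shows "\<bar>mean k (\<lambda>n. \<psi> (n + m)) - mean k \<psi>\<bar>
    \<le> 2 * K * (card ((\<lambda>n. n + m) ` B k - B k) / card (B k))"
proof -
  define B' where "B' = (\<lambda>n. n + m) ` B k"
  have fin: "finite B'" "finite (B k)"
    by (auto simp: B'_def B_finite)
  have card_eq: "card B' = card (B k)"
    unfolding B'_def by (intro card_image) (auto simp: inj_on_def)
  have "card (B' - B k) = card (B k - B')"
    using card_Diff_subset_Int[of B' "B k"] card_Diff_subset_Int[of "B k" B'] fin card_eq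
    by (simp add: Int_commute)
  moreover have "(\<Sum>n\<in>B k. \<psi> (n + m)) = sum \<psi> B'"
    unfolding B'_def by (subst sum.reindex) (auto simp: inj_on_def)
  moreover have "sum \<psi> B' = sum \<psi> (B' \<inter> B k) + sum \<psi> (B' - B k)"
    using fin by (intro sum.Int_Diff)
  moreover have "sum \<psi> (B k) = sum \<psi> (B k \<inter> B') + sum \<psi> (B k - B')"
    using fin by (intro sum.Int_Diff)
  moreover have "\<bar>sum \<psi> S\<bar> \<le> card S * K" if "finite S" for S
    using sum_norm_bound[of S \<psi> K] assms by simp
  from this[of "B' - B k"] this[of "B k - B'"]
  have "\<bar>sum \<psi> (B' - B k)\<bar> \<le> card (B' - B k) * K" "\<bar>sum \<psi> (B k - B')\<bar> \<le> card (B k - B') * K"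
    using fin by auto
  ultimately have "\<bar>(\<Sum>n\<in>B k. \<psi> (n + m)) - sum \<psi> (B k)\<bar> \<le> card (B' - B k) * K + card (B' - B k) * K"
    by (simp only: Int_commute)
  then have "\<bar>(\<Sum>n\<in>B k. \<psi> (n + m)) - sum \<psi> (B k)\<bar> / card (B k)
      \<le> 2 * K * card (B' - B k) / card (B k)"
    by (intro divide_right_mono) (auto simp: algebra_simps)
  then show ?thesis
    by (simp add: mean_def B'_def flip: diff_divide_distrib)
qed

lemma A_scale: "F \<in> A \<Longrightarrow> (\<lambda>y. c *\<^sub>R F y) \<in> A"
  using A_mult[OF A_const[of "of_real c"]] by (simp add: scaleR_conv_of_real)

lemma A_diff: "F \<in> A \<Longrightarrow> G \<in> A \<Longrightarrow> (\<lambda>y. F y - G y) \<in> A"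
  using A_add[of F "\<lambda>y. (-1) *\<^sub>R G y"] A_scale[of G "-1"] by simp

lemma A_sum: "finite S \<Longrightarrow> (\<And>n. n \<in> S \<Longrightarrow> \<Phi> n \<in> A) \<Longrightarrow> (\<lambda>y. \<Sum>n\<in>S. \<Phi> n y) \<in> A"
  by (induction S rule: finite_induct) (auto intro: A_const A_add)

lemma A_prod: "finite S \<Longrightarrow> (\<And>n. n \<in> S \<Longrightarrow> \<Phi> n \<in> A) \<Longrightarrow> (\<lambda>y. \<Prod>n\<in>S. \<Phi> n y) \<in> A"
  by (induction S rule: finite_induct) (auto intro: A_const A_mult)

lemma A_mean: "(\<And>n. \<Phi> n \<in> A) \<Longrightarrow> (\<lambda>y. mean k (\<lambda>n. \<Phi> n y)) \<in> A"
  unfolding mean_def by (intro A_scale A_sum B_finite)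

lemma Re_mult_cnj: "Re (z * cnj z) = (norm z)\<^sup>2"
  by (simp add: complex_mult_cnj cmod_power2)

lemma A_mult_cnj: "F \<in> A \<Longrightarrow> G \<in> A \<Longrightarrow> (\<lambda>y. F y * cnj (G y)) \<in> A"
  by (intro A_mult A_cnj)

lemma norm_add_square: "(norm (a + b))\<^sup>2 \<le> 2 * (norm a)\<^sup>2 + 2 * (norm b)\<^sup>2" for a b :: complex
proof -
  have "(norm (a + b))\<^sup>2 \<le> (norm a + norm b)\<^sup>2"
    by (intro power_mono norm_triangle_ineq) auto
  also have "\<dots> \<le> 2 * (norm a)\<^sup>2 + 2 * (norm b)\<^sup>2"
    using zero_le_power2[of "norm a - norm b"] by (simp add: power2_eq_square algebra_simps)
  finally show ?thesis .
qed

text \<open>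
  A state plays the role of \<open>F \<mapsto> Re (\<integral> F)\<close>. Taking the real part makes positivity a condition on real
  parts, so that a state is monotone in the real part and ignores the imaginary part.
\<close>

definition state :: "(('y \<Rightarrow> complex) \<Rightarrow> real) \<Rightarrow> bool" where
  "state t \<longleftrightarrow>
     (\<forall>F\<in>A. \<forall>G\<in>A. t (\<lambda>y. F y + G y) = t F + t G) \<and>
     (\<forall>F\<in>A. \<forall>c. t (\<lambda>y. c *\<^sub>R F y) = c * t F) \<and>
     (\<forall>F\<in>A. (\<forall>y. 0 \<le> Re (F y)) \<longrightarrow> 0 \<le> t F) \<and>
     t (\<lambda>_. 1) = 1 \<and>
     (\<forall>F\<in>A. \<forall>m. (\<forall>i. i \<notin> I \<longrightarrow> m i = 0) \<longrightarrow> t (\<lambda>y. F (act m y)) = t F)"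

text \<open>
  All estimates are phrased with the squared seminorm. The inequality \<open>\<bar>a + b\<bar>\<^sup>2 \<le> 2\<bar>a\<bar>\<^sup>2 + 2\<bar>b\<bar>\<^sup>2\<close> holds
  pointwise and therefore passes to it by monotonicity, and this replaces the triangle inequality.
\<close>

definition sqnorm :: "(('y \<Rightarrow> complex) \<Rightarrow> real) \<Rightarrow> ('y \<Rightarrow> complex) \<Rightarrow> real" where
  "sqnorm t F = t (\<lambda>y. F y * cnj (F y))"

definition cauchy :: "(('y \<Rightarrow> complex) \<Rightarrow> real) \<Rightarrow> (nat \<Rightarrow> 'y \<Rightarrow> complex) \<Rightarrow> bool" where
  "cauchy t U \<longleftrightarrow> (\<forall>e>0. \<exists>k0. \<forall>k\<ge>k0. \<forall>l\<ge>k0. sqnorm t (\<lambda>y. U k y - U l y) < e)"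

context
  fixes t assumes state: "state t"
begin

lemma state_add: "F \<in> A \<Longrightarrow> G \<in> A \<Longrightarrow> t (\<lambda>y. F y + G y) = t F + t G"
  and state_scale: "F \<in> A \<Longrightarrow> t (\<lambda>y. c *\<^sub>R F y) = c * t F"
  and state_nonneg: "F \<in> A \<Longrightarrow> (\<And>y. 0 \<le> Re (F y)) \<Longrightarrow> 0 \<le> t F"
  and state_one: "t (\<lambda>_. 1) = 1"
  and state_act: "F \<in> A \<Longrightarrow> (\<And>i. i \<notin> I \<Longrightarrow> m i = 0) \<Longrightarrow> t (\<lambda>y. F (act m y)) = t F"
  using state by (auto simp: state_def)

lemma state_diff: "F \<in> A \<Longrightarrow> G \<in> A \<Longrightarrow> t (\<lambda>y. F y - G y) = t F - t G"
  using state_add[of F "\<lambda>y. (-1) *\<^sub>R G y"] A_scale[of G "-1"] state_scale[of G "-1"] by simp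

lemma state_mono: "F \<in> A \<Longrightarrow> G \<in> A \<Longrightarrow> (\<And>y. Re (F y) \<le> Re (G y)) \<Longrightarrow> t F \<le> t G"
  using state_nonneg[of "\<lambda>y. G y - F y"] state_diff[of G F] A_diff[of G F] by simp

lemma state_cong_Re: "F \<in> A \<Longrightarrow> G \<in> A \<Longrightarrow> (\<And>y. Re (F y) = Re (G y)) \<Longrightarrow> t F = t G"
  by (intro antisym state_mono) auto

lemma state_le: "F \<in> A \<Longrightarrow> (\<And>y. Re (F y) \<le> K) \<Longrightarrow> t F \<le> K"
  using state_mono[of F "\<lambda>y. K *\<^sub>R 1"] state_scale[of "\<lambda>_. 1" K] A_const state_one
  by (simp add: scaleR_conv_of_real)

lemma state_abs_le:
  assumes "F \<in> A" "\<And>y. norm (F y) \<le> K"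
  shows "\<bar>t F\<bar> \<le> K"
proof -
  have "\<bar>Re (F y)\<bar> \<le> K" for y
    using abs_Re_le_cmod assms(2) order_trans by blast
  then have "Re (F y) \<le> K" "- Re (F y) \<le> K" for y
    by (simp_all add: abs_le_iff)
  then have "t F \<le> K" "t (\<lambda>y. (-1) *\<^sub>R F y) \<le> K"
    using assms(1) by (auto intro!: state_le A_scale[of F "-1", simplified])
  then show ?thesis
    using state_scale[OF assms(1), of "-1"] by (simp add: abs_le_iff)
qed

lemma state_sum:
  "finite S \<Longrightarrow> (\<And>n. n \<in> S \<Longrightarrow> \<Phi> n \<in> A) \<Longrightarrow> t (\<lambda>y. \<Sum>n\<in>S. \<Phi> n y) = (\<Sum>n\<in>S. t (\<Phi> n))"
proof (induction S rule: finite_induct)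
  case empty
  show ?case
    using state_scale[OF A_const, of 0 0] by simp
next
  case (insert n S)
  then show ?case
    using state_add[of "\<Phi> n" "\<lambda>y. \<Sum>n\<in>S. \<Phi> n y"] A_sum[of S \<Phi>] by simp
qed

lemma state_mean: "(\<And>n. \<Phi> n \<in> A) \<Longrightarrow> t (\<lambda>y. mean k (\<lambda>n. \<Phi> n y)) = mean k (\<lambda>n. t (\<Phi> n))"
  unfolding mean_def
  by (subst state_scale) (auto simp: state_sum B_finite intro!: A_sum)

lemma sqnorm_nonneg: "F \<in> A \<Longrightarrow> 0 \<le> sqnorm t F"
  unfolding sqnorm_def by (intro state_nonneg A_mult_cnj) (auto simp: Re_mult_cnj simp del: times_complex.sel)

lemma sqnorm_add_le:
  assumes "F \<in> A" "G \<in> A"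
  shows "sqnorm t (\<lambda>y. F y + G y) \<le> 2 * sqnorm t F + 2 * sqnorm t G"
proof -
  have "sqnorm t (\<lambda>y. F y + G y) \<le> t (\<lambda>y. 2 *\<^sub>R (F y * cnj (F y)) + 2 *\<^sub>R (G y * cnj (G y)))"
    unfolding sqnorm_def
  proof (intro state_mono A_mult_cnj A_add A_scale assms)
    fix y show "Re ((F y + G y) * cnj (F y + G y))
        \<le> Re (2 *\<^sub>R (F y * cnj (F y)) + 2 *\<^sub>R (G y * cnj (G y)))"
      using norm_add_square[of "F y" "G y"] unfolding plus_complex.sel scaleR_complex.sel Re_mult_cnj .
  qed
  also have "\<dots> = 2 * sqnorm t F + 2 * sqnorm t G"
    unfolding sqnorm_def using assms by (subst state_add) (auto simp: state_scale A_mult_cnj intro!: A_scale)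
  finally show ?thesis .
qed

lemma sqnorm_diff_le:
  assumes "F \<in> A" "G \<in> A"
  shows "sqnorm t (\<lambda>y. F y - G y) \<le> 2 * sqnorm t F + 2 * sqnorm t G"
  using sqnorm_add_le[of F "\<lambda>y. (-1) *\<^sub>R G y"] A_scale[of G "-1"] assms by (simp add: sqnorm_def)

lemma sqnorm_mult_le:
  assumes "P \<in> A" "F \<in> A" "\<And>y. norm (P y) \<le> L"
  shows "sqnorm t (\<lambda>y. P y * F y) \<le> L\<^sup>2 * sqnorm t F"
proof -
  have "sqnorm t (\<lambda>y. P y * F y) \<le> t (\<lambda>y. L\<^sup>2 *\<^sub>R (F y * cnj (F y)))"
    unfolding sqnorm_def
  proof (intro state_mono A_mult_cnj A_scale A_mult assms)
    fix y
    have "(norm (P y))\<^sup>2 * (norm (F y))\<^sup>2 \<le> L\<^sup>2 * (norm (F y))\<^sup>2"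
      using assms(3) by (intro mult_right_mono power_mono) auto
    then show "Re (P y * F y * cnj (P y * F y)) \<le> Re (L\<^sup>2 *\<^sub>R (F y * cnj (F y)))"
      unfolding scaleR_complex.sel Re_mult_cnj norm_mult power_mult_distrib by simp
  qed
  also have "\<dots> = L\<^sup>2 * sqnorm t F"
    unfolding sqnorm_def using assms by (simp add: state_scale A_mult_cnj)
  finally show ?thesis .
qed

lemma sqnorm_mean_le:
  assumes "\<And>n. \<Phi> n \<in> A"
  shows "sqnorm t (\<lambda>y. mean k (\<lambda>n. \<Phi> n y)) \<le> mean k (\<lambda>n. sqnorm t (\<Phi> n))"
proof -
  have Re_mean: "Re (mean k \<phi>) = mean k (\<lambda>n. Re (\<phi> n))" for \<phi>
    by (simp add: mean_def)
  have "sqnorm t (\<lambda>y. mean k (\<lambda>n. \<Phi> n y)) \<le> t (\<lambda>y. mean k (\<lambda>n. \<Phi> n y * cnj (\<Phi> n y)))"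
    unfolding sqnorm_def
  proof (intro state_mono A_mult_cnj A_mean assms)
    fix y
    show "Re (mean k (\<lambda>n. \<Phi> n y) * cnj (mean k (\<lambda>n. \<Phi> n y)))
        \<le> Re (mean k (\<lambda>n. \<Phi> n y * cnj (\<Phi> n y)))"
      using norm_mean_square[of k "\<lambda>n. \<Phi> n y"] unfolding Re_mean Re_mult_cnj .
  qed
  also have "\<dots> = mean k (\<lambda>n. sqnorm t (\<Phi> n))"
    unfolding sqnorm_def using assms by (intro state_mean A_mult_cnj)
  finally show ?thesis .
qed

lemma sqnorm_act: "F \<in> A \<Longrightarrow> (\<And>i. i \<notin> I \<Longrightarrow> m i = 0) \<Longrightarrow> sqnorm t (\<lambda>y. F (act m y)) = sqnorm t F"
  unfolding sqnorm_def by (intro state_act A_mult_cnj)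

lemma sqnorm_expand:
  assumes "F \<in> A" "G \<in> A"
  shows "sqnorm t (\<lambda>y. F y - c *\<^sub>R G y) = sqnorm t F - 2 * c * t (\<lambda>y. F y * cnj (G y)) + c\<^sup>2 * sqnorm t G"
proof -
  have "sqnorm t (\<lambda>y. F y - c *\<^sub>R G y) =
      t (\<lambda>y. F y * cnj (F y) - (2 * c) *\<^sub>R (F y * cnj (G y)) + c\<^sup>2 *\<^sub>R (G y * cnj (G y)))"
    unfolding sqnorm_def
    by (intro state_cong_Re A_mult_cnj A_add A_diff A_scale assms)
      (simp add: algebra_simps power2_eq_square)
  also have "\<dots> = sqnorm t F - 2 * c * t (\<lambda>y. F y * cnj (G y)) + c\<^sup>2 * sqnorm t G"
    unfolding sqnorm_def using assms
    by (simp add: state_add state_diff state_scale A_mult_cnj A_scale A_diff)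
  finally show ?thesis .
qed

end

lemma cauchy_add:
  assumes "state t" "\<And>k. U k \<in> A" "\<And>k. V k \<in> A" "cauchy t U" "cauchy t V"
  shows "cauchy t (\<lambda>k y. U k y + V k y)"
  unfolding cauchy_def
proof (intro allI impI)
  fix e :: real assume "e > 0"
  then have e: "e / 4 > 0"
    by simp
  obtain k1 where k1: "\<And>k l. k \<ge> k1 \<Longrightarrow> l \<ge> k1 \<Longrightarrow> sqnorm t (\<lambda>y. U k y - U l y) < e / 4"
    using assms(4) e unfolding cauchy_def by meson
  obtain k2 where k2: "\<And>k l. k \<ge> k2 \<Longrightarrow> l \<ge> k2 \<Longrightarrow> sqnorm t (\<lambda>y. V k y - V l y) < e / 4"
    using assms(5) e unfolding cauchy_def by meson
  have "sqnorm t (\<lambda>y. U k y + V k y - (U l y + V l y)) < e" if "k \<ge> max k1 k2" "l \<ge> max k1 k2" for k l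
    using k1[of k l] k2[of k l] that
      sqnorm_add_le[OF assms(1) A_diff[OF assms(2,2)] A_diff[OF assms(3,3)], of k l k l]
    by (simp add: algebra_simps)
  then show "\<exists>k0. \<forall>k\<ge>k0. \<forall>l\<ge>k0. sqnorm t (\<lambda>y. U k y + V k y - (U l y + V l y)) < e"
    by blast
qed

lemma cauchy_scale:
  assumes "state t" "\<And>k. U k \<in> A" "cauchy t U"
  shows "cauchy t (\<lambda>k y. c *\<^sub>R U k y)"
  unfolding cauchy_def
proof (intro allI impI)
  fix e :: real assume "e > 0"
  then have "e / (c\<^sup>2 + 1) > 0"
    by (simp add: add_nonneg_pos)
  then obtain k0 where k0: "\<And>k l. k \<ge> k0 \<Longrightarrow> l \<ge> k0 \<Longrightarrow> sqnorm t (\<lambda>y. U k y - U l y) < e / (c\<^sup>2 + 1)"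
    using assms(3) unfolding cauchy_def by metis
  have "sqnorm t (\<lambda>y. c *\<^sub>R U k y - c *\<^sub>R U l y) < e" if "k \<ge> k0" "l \<ge> k0" for k l
  proof -
    have "sqnorm t (\<lambda>y. c *\<^sub>R U k y - c *\<^sub>R U l y) \<le> \<bar>c\<bar>\<^sup>2 * sqnorm t (\<lambda>y. U k y - U l y)"
      using sqnorm_mult_le[OF assms(1) A_const A_diff[OF assms(2,2)], of "of_real c" "\<bar>c\<bar>" k l]
      by (simp add: scaleR_conv_of_real algebra_simps)
    also have "\<dots> \<le> (c\<^sup>2 + 1) * sqnorm t (\<lambda>y. U k y - U l y)"
      using sqnorm_nonneg[OF assms(1) A_diff[OF assms(2,2)], of k l] by (simp add: algebra_simps)
    also have "\<dots> < e"
      using k0[OF that] by (simp add: pos_less_divide_eq add_nonneg_pos mult.commute)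
    finally show ?thesis .
  qed
  then show "\<exists>k0. \<forall>k\<ge>k0. \<forall>l\<ge>k0. sqnorm t (\<lambda>y. c *\<^sub>R U k y - c *\<^sub>R U l y) < e"
    by blast
qed

end

section \<open>Cubic averages are Cauchy for every invariant state\<close>

context copy_system
begin

text \<open>
  The cube is replaced by a family \<open>E\<close> of index sets, so that vertices can be removed one at a time.
\<close>

definition cube_avg :: "'i set set \<Rightarrow> ('i set \<Rightarrow> 'y \<Rightarrow> complex) \<Rightarrow> nat \<Rightarrow> 'y \<Rightarrow> complex" where
  "cube_avg E f k y = mean k (\<lambda>n. \<Prod>\<beta>\<in>E. f \<beta> (act (restr \<beta> n) y))"

lemma cube_avg_in_A: "finite E \<Longrightarrow> (\<And>\<beta>. \<beta> \<in> E \<Longrightarrow> f \<beta> \<in> A) \<Longrightarrow> cube_avg E f k \<in> A"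
  unfolding cube_avg_def[abs_def] by (intro A_mean A_prod A_act)

lemma cube_avg_bounded:
  assumes "finite E" "\<And>\<beta>. \<beta> \<in> E \<Longrightarrow> f \<beta> \<in> A"
  shows "\<exists>C. \<forall>k y. norm (cube_avg E f k y) \<le> C"
proof -
  obtain K where K: "\<And>\<beta> y. \<beta> \<in> E \<Longrightarrow> norm (f \<beta> y) \<le> K \<beta>"
    using A_bounded[OF assms(2)] by metis
  have "norm (\<Prod>\<beta>\<in>E. f \<beta> (act (restr \<beta> n) y)) \<le> (\<Prod>\<beta>\<in>E. K \<beta>)" for n y
    unfolding prod_norm[symmetric] using K by (intro prod_mono) auto
  then show ?thesis
    unfolding cube_avg_def by (intro exI allI norm_mean_le)
qed

lemma cube_avg_upd:
  assumes "finite E" "\<alpha> \<in> E"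
  shows "cube_avg E (f(\<alpha> := u)) k y =
    mean k (\<lambda>n. (\<Prod>\<beta>\<in>E - {\<alpha>}. f \<beta> (act (restr \<beta> n) y)) * u (act (restr \<alpha> n) y))"
  unfolding cube_avg_def using assms by (simp add: prod.remove[of E \<alpha>] mult.commute)

lemma cube_avg_upd_add:
  assumes "finite E" "\<alpha> \<in> E"
  shows "cube_avg E (f(\<alpha> := \<lambda>y. u y + c *\<^sub>R v y)) k y =
    cube_avg E (f(\<alpha> := u)) k y + c *\<^sub>R cube_avg E (f(\<alpha> := v)) k y"
  unfolding cube_avg_upd[OF assms]
  by (simp add: ring_distribs mean_add) (simp add: mean_def scaleR_sum_right scaleR_left_commute)

lemma cube_avg_lift:
  assumes "\<And>\<beta> j n y. \<beta> \<in> E \<Longrightarrow> f' \<beta> (copy j n y) = f \<beta> y"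
  shows "cube_avg E f' k (copy j n y) = cube_avg E f k y"
  unfolding cube_avg_def using assms by (simp add: act_copy)

text \<open>
  The new functional lives on the copies: the copy \<open>(j, n)\<close> carries the old functional \<open>t\<close>, and
  \<open>n\<close> is uniformly distributed in \<open>B (r j)\<close>. The reindexing \<open>r\<close> allows to concentrate on those scales
  at which an average is large.
\<close>

definition extension :: "(nat \<Rightarrow> nat) \<Rightarrow> (('y \<Rightarrow> complex) \<Rightarrow> real) \<Rightarrow> ('y \<Rightarrow> complex) \<Rightarrow> real" where
  "extension r t F = glim (\<lambda>j. mean (r j) (\<lambda>n. t (\<lambda>y. F (copy j n y))))"

context
  fixes t and r :: "nat \<Rightarrow> nat" assumes state: "state t"
begin

lemma extension_Bseq:
  assumes "F \<in> A"
  shows "Bseq (\<lambda>j. mean (r j) (\<lambda>n. t (\<lambda>y. F (copy j n y))))"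
proof -
  obtain K where "\<And>y. norm (F y) \<le> K"
    using A_bounded[OF assms] by blast
  then show ?thesis
    by (intro BseqI'[of _ K] norm_mean_le) (simp add: state_abs_le[OF state A_copy[OF assms]])
qed

lemma extension_eq:
  assumes "\<And>j n y. F (copy j n y) = F0 y"
  shows "extension r t F = t F0"
  unfolding extension_def using assms by (simp add: mean_const glim_const)

lemma extension_ge:
  assumes "F \<in> A" "\<And>j. c \<le> mean (r j) (\<lambda>n. t (\<lambda>y. F (copy j n y)))"
  shows "c \<le> extension r t F"
  unfolding extension_def using assms by (intro glim_ge extension_Bseq) auto

lemma extension_le:
  assumes "F \<in> A" "\<And>j. mean (r j) (\<lambda>n. t (\<lambda>y. F (copy j n y))) \<le> c"
  shows "extension r t F \<le> c"
  unfolding extension_def using assms by (intro glim_le extension_Bseq) auto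

lemma extension_add: "F \<in> A \<Longrightarrow> G \<in> A \<Longrightarrow> extension r t (\<lambda>y. F y + G y) = extension r t F + extension r t G"
  unfolding extension_def by (simp add: state_add[OF state] A_copy mean_add glim_add extension_Bseq)

text \<open>
  Only the invariance needs an argument. Acting by \<open>m\<close> moves the copy \<open>(j, n)\<close> to the copy \<open>(j, n + m)\<close>
  and acts by \<open>m\<close> inside. The latter is undone by the invariance of \<open>t\<close>, the former by the
  asymptotic invariance of the sets \<open>B\<close>.
\<close>

lemma extension_state:
  assumes r: "filterlim r at_top sequentially"
  shows "state (extension r t)"
  unfolding state_def
proof (intro conjI ballI allI impI)
  fix F G assume "F \<in> A" "G \<in> A"
  then show "extension r t (\<lambda>y. F y + G y) = extension r t F + extension r t G"
    by (rule extension_add)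
next
  fix F c assume "F \<in> A"
  then show "extension r t (\<lambda>y. c *\<^sub>R F y) = c * extension r t F"
    unfolding extension_def by (simp add: state_scale[OF state] A_copy mean_scale glim_mult extension_Bseq)
next
  fix F assume "F \<in> A" "\<forall>y. 0 \<le> Re (F y)"
  then show "0 \<le> extension r t F"
    by (intro extension_ge mean_ge state_nonneg[OF state] A_copy) auto
next
  show "extension r t (\<lambda>_. 1) = 1"
    by (subst extension_eq[of _ "\<lambda>_. 1"]) (auto simp: state_one[OF state])
next
  fix F and m :: "'i \<Rightarrow> int" assume F: "F \<in> A" and m: "\<forall>i. i \<notin> I \<longrightarrow> m i = 0"
  obtain K where K: "\<And>y. norm (F y) \<le> K"
    using A_bounded[OF F] by blast
  define \<psi> where "\<psi> j n = t (\<lambda>y. F (copy j n y))" for j n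
  have \<psi>: "\<bar>\<psi> j n\<bar> \<le> K" for j n
    unfolding \<psi>_def using K by (intro state_abs_le[OF state] A_copy F)
  have shift: "t (\<lambda>y. F (act m (copy j n y))) = \<psi> j (n + m)" for j n
    using state_act[OF state, of "\<lambda>y. F (copy j (n + m) y)" m] m F
    by (simp add: \<psi>_def act_copy A_copy)
  have "(\<lambda>j. 2 * K * (card ((\<lambda>n. n + m) ` B (r j) - B (r j)) / card (B (r j)))) \<longlonglongrightarrow> 2 * K * 0"
    using m by (intro tendsto_mult_left filterlim_compose[OF Folner r]) auto
  then have null: "(\<lambda>j. 2 * K * (card ((\<lambda>n. n + m) ` B (r j) - B (r j)) / card (B (r j)))) \<longlonglongrightarrow> 0"
    by simp
  have "(\<lambda>j. mean (r j) (\<lambda>n. \<psi> j (n + m)) - mean (r j) (\<psi> j)) \<longlonglongrightarrow> 0"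
    by (rule Lim_null_comparison[OF _ null]) (use mean_shift \<psi> in auto)
  then have "glim (\<lambda>j. mean (r j) (\<lambda>n. \<psi> j (n + m)) - mean (r j) (\<psi> j)) = 0"
    by (rule glim_eq_lim)
  then have "extension r t (\<lambda>y. F (act m y) - F y) = 0"
    unfolding extension_def using F
    by (simp add: state_diff[OF state] A_copy A_act A_copy[of "\<lambda>y. F (act m y)"] shift mean_diff flip: \<psi>_def)
  moreover have "extension r t (\<lambda>y. F (act m y)) = extension r t (\<lambda>y. F (act m y) - F y) + extension r t F"
    using extension_add[OF A_diff[OF A_act[OF F] F] F] by simp
  ultimately show "extension r t (\<lambda>y. F (act m y)) = extension r t F"
    by simp
qed

lemma extension_sqnorm:
  assumes "\<And>j n y. F (copy j n y) = F0 y"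
  shows "sqnorm (extension r t) F = sqnorm t F0"
  unfolding sqnorm_def using assms by (intro extension_eq) auto

end

text \<open>
  The factor \<open>D \<beta>\<close> is evaluated at \<open>restr (\<beta> \<inter> \<alpha>) n\<close>, exactly as the function at the vertex
  \<open>\<beta> \<inter> \<alpha>\<close>, which is a vertex other than \<open>\<alpha>\<close> by maximality; it can be multiplied into that function.
  The factor \<open>H\<close> is not translated at all and goes to the vertex \<open>{}\<close>.
\<close>

lemma cube_avg_dual:
  assumes fin: "finite E" and E: "{} \<in> E" "\<And>\<beta> \<gamma>. \<beta> \<in> E \<Longrightarrow> \<gamma> \<in> E \<Longrightarrow> \<beta> \<inter> \<gamma> \<in> E"
    and \<alpha>: "\<alpha> \<in> E" "\<alpha> \<noteq> {}" and max: "\<And>\<beta>. \<beta> \<in> E \<Longrightarrow> \<alpha> \<subseteq> \<beta> \<Longrightarrow> \<beta> = \<alpha>"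
    and G: "\<And>n. G (act (restr \<alpha> n) y) = H y * (\<Prod>\<beta>\<in>E - {\<alpha>}. D \<beta> (act (restr (\<beta> \<inter> \<alpha>) n) y))"
  shows "cube_avg E (f(\<alpha> := G)) k y = cube_avg (E - {\<alpha>})
    (\<lambda>\<gamma> y. f \<gamma> y * (\<Prod>\<beta>\<in>{\<beta>\<in>E - {\<alpha>}. \<beta> \<inter> \<alpha> = \<gamma>}. D \<beta> y) * (if \<gamma> = {} then H y else 1)) k y"
proof -
  have sub: "(\<lambda>\<beta>. \<beta> \<inter> \<alpha>) ` (E - {\<alpha>}) \<subseteq> E - {\<alpha>}"
    using E \<alpha> max by auto
  have "(\<Prod>\<beta>\<in>E - {\<alpha>}. f \<beta> (act (restr \<beta> n) y)) * G (act (restr \<alpha> n) y) =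
     (\<Prod>\<gamma>\<in>E - {\<alpha>}. f \<gamma> (act (restr \<gamma> n) y) *
        (\<Prod>\<beta>\<in>{\<beta>\<in>E - {\<alpha>}. \<beta> \<inter> \<alpha> = \<gamma>}. D \<beta> (act (restr \<gamma> n) y)) *
        (if \<gamma> = {} then H (act (restr \<gamma> n) y) else 1))" for n
  proof -
    have "(\<Prod>\<gamma>\<in>E - {\<alpha>}. \<Prod>\<beta>\<in>{\<beta>\<in>E - {\<alpha>}. \<beta> \<inter> \<alpha> = \<gamma>}. D \<beta> (act (restr \<gamma> n) y)) =
        (\<Prod>\<gamma>\<in>E - {\<alpha>}. \<Prod>\<beta>\<in>{\<beta>\<in>E - {\<alpha>}. \<beta> \<inter> \<alpha> = \<gamma>}. D \<beta> (act (restr (\<beta> \<inter> \<alpha>) n) y))"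
      by (intro prod.cong) auto
    also have "\<dots> = (\<Prod>\<beta>\<in>E - {\<alpha>}. D \<beta> (act (restr (\<beta> \<inter> \<alpha>) n) y))"
      using fin sub by (intro prod.group) auto
    finally have "(\<Prod>\<gamma>\<in>E - {\<alpha>}. \<Prod>\<beta>\<in>{\<beta>\<in>E - {\<alpha>}. \<beta> \<inter> \<alpha> = \<gamma>}. D \<beta> (act (restr \<gamma> n) y)) =
      (\<Prod>\<beta>\<in>E - {\<alpha>}. D \<beta> (act (restr (\<beta> \<inter> \<alpha>) n) y))" .
    moreover have "(\<Prod>\<gamma>\<in>E - {\<alpha>}. if \<gamma> = {} then H (act (restr \<gamma> n) y) else 1) = H y"
      using fin E \<alpha> prod.delta[of "E - {\<alpha>}" "{}" "\<lambda>\<gamma>. H (act (restr \<gamma> n) y)"]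
      by (simp add: restr_empty act_zero)
    ultimately show ?thesis
      by (simp add: G prod.distrib mult_ac)
  qed
  then show ?thesis
    unfolding cube_avg_upd[OF fin \<alpha>(1)] by (simp add: cube_avg_def)
qed

text \<open>
  Here \<open>\<delta>\<close> measures the failure of the averages to be Cauchy, \<open>g\<close> is an approximation of \<open>f \<alpha>\<close> with
  Cauchy averages, and \<open>w = f \<alpha> - g\<close>. The averages \<open>h\<close> of \<open>w\<close> inherit the failure, so their squared
  norm is at least \<open>\<delta> / 16\<close> along a subsequence, which is used to build the extension. There, \<open>w\<close> has
  correlation at least \<open>\<delta> / 16\<close> with the function \<open>G\<close> assembled from the dual functions of \<open>h\<close>, and
  \<open>sqnorm\<close> of \<open>G\<close> is bounded in terms of \<open>sqnorm\<close> of \<open>w\<close>. Moving \<open>g\<close> towards \<open>f \<alpha>\<close> along \<open>G\<close> gains a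
  fixed amount. The gain depends on \<open>K\<close>, \<open>\<delta>\<close>, \<open>N0\<close> and the number of vertices only, and the bound \<open>K\<close>
  persists, so the step can be repeated.
\<close>

lemma decrease_distance:
  fixes E :: "'i set set"
  assumes fin: "finite E" and E: "{} \<in> E" "\<And>\<beta> \<gamma>. \<beta> \<in> E \<Longrightarrow> \<gamma> \<in> E \<Longrightarrow> \<beta> \<inter> \<gamma> \<in> E"
    and EI: "\<And>\<beta>. \<beta> \<in> E \<Longrightarrow> \<beta> \<subseteq> I"
    and \<alpha>: "\<alpha> \<in> E" "\<alpha> \<noteq> {}" and max: "\<And>\<beta>. \<beta> \<in> E \<Longrightarrow> \<alpha> \<subseteq> \<beta> \<Longrightarrow> \<beta> = \<alpha>"
    and IH: "\<And>t F. state t \<Longrightarrow> (\<And>\<beta>. \<beta> \<in> E - {\<alpha>} \<Longrightarrow> F \<beta> \<in> A) \<Longrightarrow> cauchy t (cube_avg (E - {\<alpha>}) F)"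
    and state: "state t"
    and f: "\<And>\<beta>. \<beta> \<in> E \<Longrightarrow> f \<beta> \<in> A" "\<And>\<beta> y. \<beta> \<in> E \<Longrightarrow> norm (f \<beta> y) \<le> K" and K: "1 \<le> K"
    and g: "g \<in> A" and good: "cauchy t (cube_avg E (f(\<alpha> := g)))"
    and \<delta>: "\<delta> > 0" and bad: "\<And>k0. \<exists>k\<ge>k0. \<exists>l\<ge>k0. \<delta> \<le> sqnorm t (\<lambda>y. cube_avg E f k y - cube_avg E f l y)"
    and N0: "sqnorm t (\<lambda>y. f \<alpha> y - g y) \<le> N0"
  shows "\<exists>t' f' g'. state t' \<and> (\<forall>\<beta>\<in>E. f' \<beta> \<in> A \<and> (\<forall>y. norm (f' \<beta> y) \<le> K)) \<and>
    g' \<in> A \<and> cauchy t' (cube_avg E (f'(\<alpha> := g'))) \<and>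
    (\<forall>k0. \<exists>k\<ge>k0. \<exists>l\<ge>k0. \<delta> \<le> sqnorm t' (\<lambda>y. cube_avg E f' k y - cube_avg E f' l y)) \<and>
    sqnorm t' (\<lambda>y. f' \<alpha> y - g' y) \<le> sqnorm t (\<lambda>y. f \<alpha> y - g y) - (\<delta> / 16)\<^sup>2 / ((K ^ card (E - {\<alpha>})) ^ 4 * (N0 + 1))"
proof -
  define L where "L = K ^ card (E - {\<alpha>})"
  have L: "1 \<le> L"
    unfolding L_def using K by (rule one_le_power)
  define w where "w = (\<lambda>y. f \<alpha> y - g y)"
  define P where "P n y = (\<Prod>\<beta>\<in>E - {\<alpha>}. f \<beta> (act (restr \<beta> n) y))" for n y
  define h where "h = cube_avg E (f(\<alpha> := w))"
  \<comment> \<open>The estimate of the square norm of a sum loses a factor 2 twice: when the averages of \<open>g\<close> are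
    split off, and when the difference of two averages of \<open>w\<close> is split. Half of \<open>\<delta>\<close> is given up to the
    averages of \<open>g\<close>, and a further factor 2 in the choice of one of the two averages of \<open>w\<close>.\<close>
  define s where "s = \<delta> / 16"
  have w: "w \<in> A"
    unfolding w_def using f g \<alpha> by (intro A_diff)
  have P: "P n \<in> A" for n
    unfolding P_def[abs_def] using f fin by (intro A_prod A_act) auto
  have P_le: "norm (P n y) \<le> L" for n y
    unfolding P_def L_def prod_norm[symmetric] prod_constant[symmetric] using f by (intro prod_mono) auto
  have h_eq: "h k y = mean k (\<lambda>n. P n y * w (act (restr \<alpha> n) y))" for k y
    unfolding h_def P_def by (rule cube_avg_upd[OF fin \<alpha>(1)])
  have hA: "h k \<in> A" for k
    unfolding h_def using f w by (intro cube_avg_in_A fin) auto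
  have fA: "cube_avg E f k \<in> A" and gA: "cube_avg E (f(\<alpha> := g)) k \<in> A" for k
    using f g by (auto intro!: cube_avg_in_A fin)
  have h_diff: "cube_avg E f k y = h k y + cube_avg E (f(\<alpha> := g)) k y" for k y
    using cube_avg_upd_add[OF fin \<alpha>(1), of f w 1 g k y] by (simp add: h_def w_def)
  have supp: "restr \<alpha> n i = 0" "(- restr \<alpha> n) i = 0" if "i \<notin> I" for n i
    using EI[OF \<alpha>(1)] that by (auto simp: restr_def)
  have h_N: "sqnorm t (h k) \<le> L\<^sup>2 * sqnorm t w" for k
  proof -
    have "sqnorm t (h k) \<le> mean k (\<lambda>n. sqnorm t (\<lambda>y. P n y * w (act (restr \<alpha> n) y)))"
      unfolding h_eq[abs_def] by (intro sqnorm_mean_le state A_mult A_act P w)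
    also have "\<dots> \<le> L\<^sup>2 * sqnorm t w"
    proof (rule mean_le)
      fix n
      show "sqnorm t (\<lambda>y. P n y * w (act (restr \<alpha> n) y)) \<le> L\<^sup>2 * sqnorm t w"
        using sqnorm_mult_le[OF state P A_act[OF w] P_le, of n "restr \<alpha> n"]
        by (simp add: sqnorm_act[OF state w supp(1)])
    qed
    finally show ?thesis .
  qed
  have "\<exists>k\<ge>k0. s \<le> sqnorm t (h k)" for k0
  proof -
    have "\<delta> / 4 > 0"
      using \<delta> by simp
    then obtain k1 where k1: "\<And>k l. k \<ge> k1 \<Longrightarrow> l \<ge> k1 \<Longrightarrow>
        sqnorm t (\<lambda>y. cube_avg E (f(\<alpha> := g)) k y - cube_avg E (f(\<alpha> := g)) l y) < \<delta> / 4"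
      using good unfolding cauchy_def by meson
    obtain k l where kl: "k \<ge> max k0 k1" "l \<ge> max k0 k1"
      and kl_bad: "\<delta> \<le> sqnorm t (\<lambda>y. cube_avg E f k y - cube_avg E f l y)"
      using bad by blast
    note kl_bad
    also have "(\<lambda>y. cube_avg E f k y - cube_avg E f l y) =
        (\<lambda>y. (h k y - h l y) + (cube_avg E (f(\<alpha> := g)) k y - cube_avg E (f(\<alpha> := g)) l y))"
      by (simp add: h_diff algebra_simps)
    also have "sqnorm t \<dots> \<le> 2 * sqnorm t (\<lambda>y. h k y - h l y) +
        2 * sqnorm t (\<lambda>y. cube_avg E (f(\<alpha> := g)) k y - cube_avg E (f(\<alpha> := g)) l y)"
      by (intro sqnorm_add_le state A_diff hA gA)
    finally have "\<delta> / 4 \<le> sqnorm t (\<lambda>y. h k y - h l y)"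
      using k1[of k l] kl by simp
    then have "\<delta> / 4 \<le> 2 * sqnorm t (h k) + 2 * sqnorm t (h l)"
      using sqnorm_diff_le[OF state hA hA, of k l] by linarith
    then have "s \<le> sqnorm t (h k) \<or> s \<le> sqnorm t (h l)"
      unfolding s_def by linarith
    then show ?thesis
      using kl by auto
  qed
  then obtain r where r_ge: "\<And>j. r j \<ge> j" and r: "\<And>j. s \<le> sqnorm t (h (r j))"
    by metis
  have r_lim: "filterlim r at_top sequentially"
    by (rule filterlim_at_top_mono[OF filterlim_ident]) (auto simp: r_ge)
  define t' where "t' = extension r t"
  have state': "state t'"
    unfolding t'_def by (intro extension_state state r_lim)

  have lift: "\<exists>F'\<in>A. (\<forall>y. norm (F' y) \<le> C) \<and> (\<forall>j n y. F' (copy j n y) = F y)"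
    if "F \<in> A" "\<And>y. norm (F y) \<le> C" for F C
    using A_glue[of "\<lambda>j n. F" C] that by blast
  have "\<forall>\<beta>\<in>E. \<exists>F'. F' \<in> A \<and> (\<forall>y. norm (F' y) \<le> K) \<and> (\<forall>j n y. F' (copy j n y) = f \<beta> y)"
    using lift f by blast
  then obtain f' where f': "\<And>\<beta>. \<beta> \<in> E \<Longrightarrow> f' \<beta> \<in> A" "\<And>\<beta> y. \<beta> \<in> E \<Longrightarrow> norm (f' \<beta> y) \<le> K"
      "\<And>\<beta> j n y. \<beta> \<in> E \<Longrightarrow> f' \<beta> (copy j n y) = f \<beta> y"
    by metis
  obtain g1 where g1: "g1 \<in> A" "\<And>j n y. g1 (copy j n y) = g y"
    using lift[OF g] A_bounded[OF g] by metis
  have "\<exists>D\<in>A. \<forall>j n y. D (copy j n y) = cnj (f \<beta> (act (restr \<beta> n - restr \<alpha> n) y))" if "\<beta> \<in> E" for \<beta>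
  proof -
    have "(\<lambda>y. cnj (f \<beta> (act m y))) \<in> A" for m
      using that by (intro A_cnj A_act f)
    moreover have "norm (cnj (f \<beta> (act m y))) \<le> K" for m y
      using f(2)[OF that] by simp
    ultimately show ?thesis
      using A_glue[of "\<lambda>j n y. cnj (f \<beta> (act (restr \<beta> n - restr \<alpha> n) y))" K] by blast
  qed
  then obtain D where D: "\<And>\<beta>. \<beta> \<in> E \<Longrightarrow> D \<beta> \<in> A"
      "\<And>\<beta> j n y. \<beta> \<in> E \<Longrightarrow> D \<beta> (copy j n y) = cnj (f \<beta> (act (restr \<beta> n - restr \<alpha> n) y))"
    by metis
  have "\<exists>C. \<forall>k y. norm (h k y) \<le> C"
    unfolding h_def using f w by (intro cube_avg_bounded fin) auto
  then obtain C where C: "\<And>k y. norm (h k y) \<le> C"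
    by blast
  \<comment> \<open>\<open>H\<close> and \<open>D\<close> are the factors of \<open>G\<close>. They are glued separately, because the factors, and
    not only their product, have to be functions on the extension.\<close>
  obtain H where H: "H \<in> A" "\<And>j n y. H (copy j n y) = h (r j) (act (- restr \<alpha> n) y)"
    using A_glue[of "\<lambda>j n y. h (r j) (act (- restr \<alpha> n) y)" C] C hA A_act by metis
  define G where "G y = H y * (\<Prod>\<beta>\<in>E - {\<alpha>}. D \<beta> y)" for y
  have G: "G \<in> A"
    unfolding G_def[abs_def] using D fin by (intro A_mult H A_prod) auto
  have G_cp: "G (copy j n y) = h (r j) (act (- restr \<alpha> n) y) * cnj (P n (act (- restr \<alpha> n) y))" for j n y
    unfolding G_def P_def using D H by (simp add: act_add[symmetric])
  \<comment> \<open>Acting by \<open>restr \<alpha> p\<close> translates \<open>n\<close> as well as the point. In \<open>H\<close> the two effects cancel, and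
    in \<open>D \<beta>\<close> exactly the part of \<open>p\<close> supported in \<open>\<beta> \<inter> \<alpha>\<close> remains.\<close>
  have G_act: "G (act (restr \<alpha> p) (copy j n y)) =
      H (copy j n y) * (\<Prod>\<beta>\<in>E - {\<alpha>}. D \<beta> (act (restr (\<beta> \<inter> \<alpha>) p) (copy j n y)))" for p j n y
  proof -
    have H_shift: "- restr \<alpha> (n + restr \<alpha> p) + restr \<alpha> p = - restr \<alpha> n"
      by (auto simp: restr_def fun_eq_iff)
    have "restr \<beta> (n + restr \<alpha> p) - restr \<alpha> (n + restr \<alpha> p) + restr \<alpha> p =
        restr \<beta> (n + restr (\<beta> \<inter> \<alpha>) p) - restr \<alpha> (n + restr (\<beta> \<inter> \<alpha>) p) + restr (\<beta> \<inter> \<alpha>) p" for \<beta>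
      by (auto simp: restr_def fun_eq_iff)
    then have "D \<beta> (act (restr \<alpha> p) (copy j n y)) = D \<beta> (act (restr (\<beta> \<inter> \<alpha>) p) (copy j n y))"
      if "\<beta> \<in> E" for \<beta>
      by (simp only: act_copy D(2)[OF that] act_add[symmetric])
    moreover have "H (act (restr \<alpha> p) (copy j n y)) = H (copy j n y)"
      by (simp only: act_copy H act_add[symmetric] H_shift)
    ultimately show ?thesis
      unfolding G_def by simp
  qed

  have cube_avg_f': "cube_avg E f' k (copy j n y) = cube_avg E f k y" for k j n y
    using f' by (intro cube_avg_lift) auto
  have cube_avg_g1: "cube_avg E (f'(\<alpha> := g1)) k (copy j n y) = cube_avg E (f(\<alpha> := g)) k y" for k j n y
    using f' g1 by (intro cube_avg_lift) auto
  define F where "F = (\<lambda>\<gamma> y. f' \<gamma> y * (\<Prod>\<beta>\<in>{\<beta>\<in>E - {\<alpha>}. \<beta> \<inter> \<alpha> = \<gamma>}. D \<beta> y) * (if \<gamma> = {} then H y else 1))"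
  have "cauchy t' (cube_avg (E - {\<alpha>}) F)"
  proof (rule IH[OF state'])
    fix \<gamma> assume \<gamma>: "\<gamma> \<in> E - {\<alpha>}"
    have "(\<lambda>y. if \<gamma> = {} then H y else 1) \<in> A"
      using H A_const by (cases "\<gamma> = {}") auto
    then show "F \<gamma> \<in> A"
      unfolding F_def using \<gamma> f' D fin by (intro A_mult A_prod) auto
  qed
  moreover have cube_avg_G: "cube_avg E (f'(\<alpha> := G)) k (copy j n y) = cube_avg (E - {\<alpha>}) F k (copy j n y)" for k j n y
    unfolding F_def by (intro cube_avg_dual fin E \<alpha> max G_act)
  have "sqnorm t' (\<lambda>y. cube_avg E (f'(\<alpha> := G)) k y - cube_avg E (f'(\<alpha> := G)) l y) =
      sqnorm t' (\<lambda>y. cube_avg (E - {\<alpha>}) F k y - cube_avg (E - {\<alpha>}) F l y)" for k l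
    unfolding sqnorm_def t'_def extension_def cube_avg_G by simp
  ultimately have G_good: "cauchy t' (cube_avg E (f'(\<alpha> := G)))"
    unfolding cauchy_def by simp
  have "sqnorm t' (\<lambda>y. cube_avg E (f'(\<alpha> := g1)) k y - cube_avg E (f'(\<alpha> := g1)) l y) =
      sqnorm t (\<lambda>y. cube_avg E (f(\<alpha> := g)) k y - cube_avg E (f(\<alpha> := g)) l y)" for k l
    unfolding t'_def by (intro extension_sqnorm state) (simp add: cube_avg_g1)
  with good have g1_good: "cauchy t' (cube_avg E (f'(\<alpha> := g1)))"
    unfolding cauchy_def by simp
  have bad': "\<exists>k\<ge>k0. \<exists>l\<ge>k0. \<delta> \<le> sqnorm t' (\<lambda>y. cube_avg E f' k y - cube_avg E f' l y)" for k0
  proof -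
    have "sqnorm t' (\<lambda>y. cube_avg E f' k y - cube_avg E f' l y) = sqnorm t (\<lambda>y. cube_avg E f k y - cube_avg E f l y)" for k l
      unfolding t'_def by (intro extension_sqnorm state) (simp add: cube_avg_f')
    then show ?thesis
      using bad by simp
  qed

  define w' where "w' = (\<lambda>y. f' \<alpha> y - g1 y)"
  have w': "w' \<in> A" "\<And>j n y. w' (copy j n y) = w y"
    unfolding w'_def w_def using f' g1 \<alpha> by (auto intro: A_diff)
  have corr: "s \<le> t' (\<lambda>y. w' y * cnj (G y))"
    unfolding t'_def
  proof (intro extension_ge state A_mult_cnj w' G)
    fix j
    have "t (\<lambda>y. w' (copy j n y) * cnj (G (copy j n y))) =
        t (\<lambda>y. P n y * w (act (restr \<alpha> n) y) * cnj (h (r j) y))" for n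
    proof -
      have GA: "(\<lambda>y. w y * cnj (G (copy j n y))) \<in> A"
        by (intro A_mult_cnj w A_copy G)
      have "t (\<lambda>y. w' (copy j n y) * cnj (G (copy j n y))) = t (\<lambda>y. w y * cnj (G (copy j n y)))"
        by (simp add: w')
      also have "\<dots> = t (\<lambda>y. w (act (restr \<alpha> n) y) * cnj (G (copy j n (act (restr \<alpha> n) y))))"
        using state_act[OF state GA supp(1)] by simp
      also have "\<dots> = t (\<lambda>y. P n y * w (act (restr \<alpha> n) y) * cnj (h (r j) y))"
        by (simp add: G_cp act_add[symmetric] act_zero mult_ac)
      finally show ?thesis .
    qed
    then have "mean (r j) (\<lambda>n. t (\<lambda>y. w' (copy j n y) * cnj (G (copy j n y)))) =
        mean (r j) (\<lambda>n. t (\<lambda>y. P n y * w (act (restr \<alpha> n) y) * cnj (h (r j) y)))"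
      by simp
    also have "\<dots> = t (\<lambda>y. mean (r j) (\<lambda>n. P n y * w (act (restr \<alpha> n) y) * cnj (h (r j) y)))"
      by (rule state_mean[OF state, symmetric]) (intro A_mult_cnj A_mult P A_act w hA)
    also have "\<dots> = sqnorm t (h (r j))"
      unfolding sqnorm_def by (simp only: mean_mult_right h_eq)
    finally show "s \<le> mean (r j) (\<lambda>n. t (\<lambda>y. w' (copy j n y) * cnj (G (copy j n y))))"
      using r by simp
  qed
  have sqnorm_G: "sqnorm t' G \<le> L ^ 4 * sqnorm t w"
    unfolding t'_def sqnorm_def[of "extension r t"]
  proof (intro extension_le state A_mult_cnj G mean_le)
    fix j n
    have "t (\<lambda>y. G (copy j n y) * cnj (G (copy j n y))) = sqnorm t (\<lambda>y. G (copy j n y))"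
      by (simp add: sqnorm_def)
    also have "\<dots> = sqnorm t (\<lambda>y. G (copy j n (act (restr \<alpha> n) y)))"
      using sqnorm_act[OF state A_copy[OF G] supp(1)] by simp
    also have "\<dots> = sqnorm t (\<lambda>y. cnj (P n y) * h (r j) y)"
      by (simp add: G_cp act_add[symmetric] act_zero mult_ac)
    also have "\<dots> \<le> L\<^sup>2 * sqnorm t (h (r j))"
      by (intro sqnorm_mult_le state A_cnj P hA) (simp add: P_le)
    also have "\<dots> \<le> L\<^sup>2 * (L\<^sup>2 * sqnorm t w)"
      by (intro mult_left_mono h_N) auto
    finally show "t (\<lambda>y. G (copy j n y) * cnj (G (copy j n y))) \<le> L ^ 4 * sqnorm t w"
      by (simp add: power2_eq_square power4_eq_xxxx)
  qed

  define R where "R = L ^ 4 * (N0 + 1)"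
  have Nw: "0 \<le> sqnorm t w" "sqnorm t w \<le> N0"
    using sqnorm_nonneg[OF state w] N0 by (auto simp: w_def)
  have R: "0 < R"
    unfolding R_def using L Nw by (intro mult_pos_pos) auto
  have sqnorm_G': "sqnorm t' G \<le> R"
    using sqnorm_G Nw L unfolding R_def by (smt (verit) mult_left_mono zero_le_power)
  \<comment> \<open>The value of \<open>c\<close> that minimises the bound \<open>sqnorm t w - 2 * c * s + c\<^sup>2 * R\<close>.\<close>
  define c where "c = s / R"
  define g' where "g' = (\<lambda>y. g1 y + c *\<^sub>R G y)"
  have g': "g' \<in> A"
    unfolding g'_def by (intro A_add A_scale g1 G)
  have "cauchy t' (\<lambda>k y. cube_avg E (f'(\<alpha> := g1)) k y + c *\<^sub>R cube_avg E (f'(\<alpha> := G)) k y)"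
    using f' g1 G
    by (intro cauchy_add cauchy_scale state' A_scale cube_avg_in_A fin g1_good G_good) auto
  then have g'_good: "cauchy t' (cube_avg E (f'(\<alpha> := g')))"
    unfolding g'_def cauchy_def cube_avg_upd_add[OF fin \<alpha>(1)] .
  have "(\<lambda>y. f' \<alpha> y - g' y) = (\<lambda>y. w' y - c *\<^sub>R G y)"
    by (simp add: g'_def w'_def fun_eq_iff)
  then have "sqnorm t' (\<lambda>y. f' \<alpha> y - g' y) = sqnorm t' w' - 2 * c * t' (\<lambda>y. w' y * cnj (G y)) + c\<^sup>2 * sqnorm t' G"
    using sqnorm_expand[OF state' w'(1) G] by simp
  also have "sqnorm t' w' = sqnorm t w"
    unfolding t'_def using w' by (intro extension_sqnorm state) auto
  also have "sqnorm t w - 2 * c * t' (\<lambda>y. w' y * cnj (G y)) + c\<^sup>2 * sqnorm t' G \<le> sqnorm t w - 2 * c * s + c\<^sup>2 * R"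
    using corr sqnorm_G' R \<delta> by (intro add_mono diff_mono mult_left_mono) (auto simp: c_def s_def)
  also have "\<dots> = sqnorm t w - s\<^sup>2 / R"
    using R by (simp add: c_def power2_eq_square field_simps)
  finally have "sqnorm t' (\<lambda>y. f' \<alpha> y - g' y) \<le> sqnorm t w - s\<^sup>2 / R" .
  then show ?thesis
    using state' f' g' g'_good bad' unfolding s_def R_def L_def w_def
    by (intro exI[of _ t'] exI[of _ f'] exI[of _ g']) auto
qed

text \<open>
  Induction on the number of vertices. For a maximal vertex other than \<open>{}\<close>, start from the
  approximation 0 and apply \<open>decrease_distance\<close> until the squared distance would be negative.
\<close>

theorem cube_avg_cauchy:
  assumes "finite E" "{} \<in> E" "\<And>\<beta> \<gamma>. \<beta> \<in> E \<Longrightarrow> \<gamma> \<in> E \<Longrightarrow> \<beta> \<inter> \<gamma> \<in> E" "\<And>\<beta>. \<beta> \<in> E \<Longrightarrow> \<beta> \<subseteq> I"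
    "state t" "\<And>\<beta>. \<beta> \<in> E \<Longrightarrow> f \<beta> \<in> A"
  shows "cauchy t (cube_avg E f)"
  using assms
proof (induction "card E" arbitrary: E t f rule: less_induct)
  case less
  note fin = less.prems(1) and E = less.prems(2,3) and EI = less.prems(4)
    and state = less.prems(5) and f = less.prems(6)
  obtain \<alpha> where \<alpha>: "\<alpha> \<in> E" and max: "\<And>\<beta>. \<beta> \<in> E \<Longrightarrow> \<alpha> \<subseteq> \<beta> \<Longrightarrow> \<beta> = \<alpha>"
    using finite_has_maximal[OF fin] E by (metis empty_iff)
  show ?case
  proof (cases "\<alpha> = {}")
    case True
    then have "E = {{}}"
      using max \<alpha> by auto
    then have "cube_avg E f k = f {}" for k
      by (simp add: cube_avg_def fun_eq_iff restr_empty act_zero mean_const)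
    then show ?thesis
      using state_scale[OF state A_const, of 0 0] by (simp add: cauchy_def sqnorm_def)
  next
    case ne: False
    have IH: "cauchy t (cube_avg (E - {\<alpha>}) F)" if "state t" "\<And>\<beta>. \<beta> \<in> E - {\<alpha>} \<Longrightarrow> F \<beta> \<in> A" for t F
    proof (rule less.hyps)
      show "card (E - {\<alpha>}) < card E"
        using fin \<alpha> by (rule card_Diff1_less)
      show "\<beta> \<inter> \<gamma> \<in> E - {\<alpha>}" if "\<beta> \<in> E - {\<alpha>}" "\<gamma> \<in> E - {\<alpha>}" for \<beta> \<gamma>
        using that E(2) max by (metis Diff_iff inf.cobounded1 insertI1 singletonD)
    qed (use fin E EI ne that in auto)
    show ?thesis
    proof (rule ccontr)
      assume "\<not> cauchy t (cube_avg E f)"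
      then obtain \<delta> where \<delta>: "\<delta> > 0"
        and bad: "\<And>k0. \<exists>k\<ge>k0. \<exists>l\<ge>k0. \<delta> \<le> sqnorm t (\<lambda>y. cube_avg E f k y - cube_avg E f l y)"
        unfolding cauchy_def by (metis not_less)
      have "\<exists>K. \<forall>\<beta>\<in>E. \<forall>y. norm (f \<beta> y) \<le> K"
      proof -
        have "\<forall>\<beta>\<in>E. \<exists>K. \<forall>y. norm (f \<beta> y) \<le> K"
          using f A_bounded by blast
        then obtain K where K: "\<And>\<beta> y. \<beta> \<in> E \<Longrightarrow> norm (f \<beta> y) \<le> K \<beta>"
          by metis
        have "norm (f \<beta> y) \<le> Max (K ` E)" if "\<beta> \<in> E" for \<beta> y
          using K[OF that] fin that by (meson Max_ge finite_imageI image_eqI order_trans)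
        then show ?thesis
          by blast
      qed
      then obtain K0 where K0: "\<And>\<beta> y. \<beta> \<in> E \<Longrightarrow> norm (f \<beta> y) \<le> K0"
        by blast
      define K where "K = max 1 K0"
      define N0 where "N0 = sqnorm t (f \<alpha>)"
      define \<eta> where "\<eta> = (\<delta> / 16)\<^sup>2 / ((K ^ card (E - {\<alpha>})) ^ 4 * (N0 + 1))"
      have "0 \<le> N0"
        unfolding N0_def using f \<alpha> by (intro sqnorm_nonneg state)
      then have \<eta>: "\<eta> > 0"
        unfolding \<eta>_def K_def using \<delta> by (intro divide_pos_pos mult_pos_pos zero_less_power) auto
      \<comment> \<open>After \<open>j\<close> steps there is an extension in which the averages still fail to be Cauchy by \<open>\<delta>\<close>,
        while an approximation at squared distance at most \<open>N0 - j * \<eta>\<close> has Cauchy averages.\<close>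
      define config where "config t' f' g' j \<longleftrightarrow> state t' \<and>
        (\<forall>\<beta>\<in>E. f' \<beta> \<in> A \<and> (\<forall>y. norm (f' \<beta> y) \<le> K)) \<and>
        g' \<in> A \<and> cauchy t' (cube_avg E (f'(\<alpha> := g'))) \<and>
        (\<forall>k0. \<exists>k\<ge>k0. \<exists>l\<ge>k0. \<delta> \<le> sqnorm t' (\<lambda>y. cube_avg E f' k y - cube_avg E f' l y)) \<and>
        sqnorm t' (\<lambda>y. f' \<alpha> y - g' y) \<le> N0 - real j * \<eta>" for t' f' g' and j :: nat
      have "\<exists>t' f' g'. config t' f' g' j" for j
      proof (induction j)
        case 0
        have "cube_avg E (f(\<alpha> := \<lambda>_. 0)) k y = 0" for k y
          by (simp add: cube_avg_upd[OF fin \<alpha>] mean_def)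
        then have "config t f (\<lambda>_. 0) 0"
          using state f bad A_const state_scale[OF state A_const, of 0 0] K0
          by (auto simp: config_def cauchy_def sqnorm_def N0_def K_def le_max_iff_disj)
        then show ?case
          by blast
      next
        case (Suc j)
        then obtain t' f' g' where c: "config t' f' g' j"
          by blast
        have "1 \<le> K" "real j * \<eta> \<ge> 0"
          using \<eta> by (auto simp: K_def)
        then have le: "sqnorm t' (\<lambda>y. f' \<alpha> y - g' y) \<le> N0"
          using c by (auto simp: config_def)
        obtain t'' f'' g'' where *: "state t''" "\<forall>\<beta>\<in>E. f'' \<beta> \<in> A \<and> (\<forall>y. norm (f'' \<beta> y) \<le> K)"
          "g'' \<in> A" "cauchy t'' (cube_avg E (f''(\<alpha> := g'')))"
          "\<forall>k0. \<exists>k\<ge>k0. \<exists>l\<ge>k0. \<delta> \<le> sqnorm t'' (\<lambda>y. cube_avg E f'' k y - cube_avg E f'' l y)"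
          "sqnorm t'' (\<lambda>y. f'' \<alpha> y - g'' y) \<le> sqnorm t' (\<lambda>y. f' \<alpha> y - g' y) - \<eta>"
          using decrease_distance[OF fin E EI \<alpha> ne max IH, of t' f' K g' \<delta> N0] c \<open>1 \<le> K\<close> le \<delta>
          unfolding \<eta>_def config_def by blast
        then have "config t'' f'' g'' (Suc j)"
          using c by (auto simp: config_def algebra_simps)
        then show ?case
          by blast
      qed
      moreover obtain j where "N0 < real j * \<eta>"
        using ex_less_of_nat_mult[OF \<eta>] by blast
      ultimately obtain t' f' g' where c: "config t' f' g' j"
        by blast
      then have "0 \<le> sqnorm t' (\<lambda>y. f' \<alpha> y - g' y)"
        using \<alpha> by (intro sqnorm_nonneg A_diff) (auto simp: config_def)
      then show False
        using c \<open>N0 < real j * \<eta>\<close> by (auto simp: config_def)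
    qed
  qed
qed

end

section \<open>Completeness of square integrable functions\<close>

text \<open>
  On a probability space square norm convergence controls convergence in the mean, so a subsequence
  converges almost everywhere; the uniform bound turns this into square norm convergence of the
  subsequence, and the Cauchy property extends it to the whole sequence.
\<close>

lemma (in prob_space) convergent_in_L2_Cauchy:
  fixes A :: "nat \<Rightarrow> 'a \<Rightarrow> complex"
  assumes meas[measurable]: "\<And>k. A k \<in> borel_measurable M"
    and bound: "\<And>k x. x \<in> space M \<Longrightarrow> norm (A k x) \<le> K"
    and cauchy: "\<And>e. e > 0 \<Longrightarrow> \<exists>k0. \<forall>k\<ge>k0. \<forall>l\<ge>k0. (\<integral>x. (norm (A k x - A l x))\<^sup>2 \<partial>M) < e"
  shows "convergent_in_L2 M A"
proof -
  have K: "0 \<le> K"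
    using bound not_empty norm_ge_zero order_trans by blast
  have int: "integrable M (A k)" for k
    using bound by (intro integrable_const_bound[of _ K]) auto
  have int2: "integrable M (\<lambda>x. (norm (F x - G x))\<^sup>2)"
    if [measurable]: "F \<in> borel_measurable M" "G \<in> borel_measurable M"
      and "AE x in M. norm (F x) \<le> K" "AE x in M. norm (G x) \<le> K" for F G :: "'a \<Rightarrow> complex"
  proof (rule integrable_const_bound[of _ "(2 * K)\<^sup>2"])
    show "AE x in M. norm ((norm (F x - G x))\<^sup>2) \<le> (2 * K)\<^sup>2"
      using that(3,4)
    proof eventually_elim
      case (elim x)
      then have "norm (F x - G x) \<le> 2 * K"
        using norm_triangle_ineq4[of "F x" "G x"] by linarith
      then show ?case
        using power_mono[of _ "2 * K" 2] by simp
    qed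
  qed simp
  have AE_bound: "AE x in M. norm (A k x) \<le> K" for k
    using bound by simp
  have "\<exists>k0. \<forall>k\<ge>k0. \<forall>l\<ge>k0. (\<integral>x. norm (A k x - A l x) \<partial>M) < e" if "e > 0" for e
  proof -
    obtain k0 where k0: "\<And>k l. k \<ge> k0 \<Longrightarrow> l \<ge> k0 \<Longrightarrow> (\<integral>x. (norm (A k x - A l x))\<^sup>2 \<partial>M) < e\<^sup>2"
      using cauchy[of "e\<^sup>2"] \<open>e > 0\<close> by auto
    have "(\<integral>x. norm (A k x - A l x) \<partial>M) < e" if kl: "k \<ge> k0" "l \<ge> k0" for k l
    proof -
      \<comment> \<open>A pointwise form of the Cauchy-Schwarz inequality, with the weight adapted to \<open>e\<close>.\<close>
      have amgm: "z \<le> e / 2 + z\<^sup>2 / (2 * e)" for z :: real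
        using \<open>e > 0\<close> zero_le_power2[of "z - e"] by (simp add: field_simps power2_eq_square)
      have "(\<integral>x. norm (A k x - A l x) \<partial>M) \<le> (\<integral>x. e / 2 + (norm (A k x - A l x))\<^sup>2 / (2 * e) \<partial>M)"
        using int int2[OF meas meas AE_bound AE_bound]
        by (intro integral_mono amgm) auto
      also have "\<dots> = e / 2 + (\<integral>x. (norm (A k x - A l x))\<^sup>2 \<partial>M) / (2 * e)"
        using int2[OF meas meas AE_bound AE_bound] by (simp add: prob_space)
      also have "\<dots> < e / 2 + e\<^sup>2 / (2 * e)"
        using k0[OF kl] \<open>e > 0\<close> by (simp add: divide_strict_right_mono)
      also have "\<dots> = e"
        using \<open>e > 0\<close> by (simp add: power2_eq_square)
      finally show ?thesis .
    qed
    then show ?thesis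
      by blast
  qed
  then obtain r where r: "strict_mono r" and AE_r: "AE x in M. Cauchy (\<lambda>i. A (r i) x)"
    by (rule cauchy_L1_AE_cauchy_subseq[OF int])
  define F where "F x = lim (\<lambda>i. A (r i) x)" for x
  have F_meas[measurable]: "F \<in> borel_measurable M"
    unfolding F_def[abs_def] by measurable
  have lim: "AE x in M. (\<lambda>i. A (r i) x) \<longlonglongrightarrow> F x"
    using AE_r
  proof eventually_elim
    case (elim x)
    then show ?case
      unfolding F_def by (simp add: Cauchy_convergent convergent_LIMSEQ_iff[symmetric])
  qed
  have F_bound: "AE x in M. norm (F x) \<le> K"
    using lim AE_space
  proof eventually_elim
    case (elim x)
    then show ?case
      using bound by (intro tendsto_upperbound[OF tendsto_norm[OF elim(1)]]) auto
  qed
  have "(\<lambda>i. \<integral>x. (norm (A (r i) x - F x))\<^sup>2 \<partial>M) \<longlonglongrightarrow> (\<integral>x. 0 \<partial>M)"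
  proof (rule integral_dominated_convergence[where w = "\<lambda>_. (2 * K)\<^sup>2"])
    show "AE x in M. (\<lambda>i. (norm (A (r i) x - F x))\<^sup>2) \<longlonglongrightarrow> 0"
      using lim
    proof eventually_elim
      case (elim x)
      have "(\<lambda>i. (norm (A (r i) x - F x))\<^sup>2) \<longlonglongrightarrow> (norm (F x - F x))\<^sup>2"
        by (intro tendsto_intros elim)
      then show ?case
        by simp
    qed
    show "AE x in M. norm ((norm (A (r i) x - F x))\<^sup>2) \<le> (2 * K)\<^sup>2" for i
      using F_bound AE_bound[of "r i"]
    proof eventually_elim
      case (elim x)
      then have "norm (A (r i) x - F x) \<le> 2 * K"
        using norm_triangle_ineq4[of "A (r i) x" "F x"] by linarith
      then show ?case
        using power_mono[of _ "2 * K" 2] by simp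
    qed
  qed auto
  then have sub: "(\<lambda>i. \<integral>x. (norm (A (r i) x - F x))\<^sup>2 \<partial>M) \<longlonglongrightarrow> 0"
    by simp
  have "(\<lambda>k. \<integral>x. (norm (A k x - F x))\<^sup>2 \<partial>M) \<longlonglongrightarrow> 0"
  proof (rule LIMSEQ_I)
    fix e :: real assume e: "e > 0"
    obtain k0 where k0: "\<And>k l. k \<ge> k0 \<Longrightarrow> l \<ge> k0 \<Longrightarrow> (\<integral>x. (norm (A k x - A l x))\<^sup>2 \<partial>M) < e / 4"
      using cauchy[of "e / 4"] e by auto
    obtain i0 where i0: "\<And>i. i \<ge> i0 \<Longrightarrow> norm (\<integral>x. (norm (A (r i) x - F x))\<^sup>2 \<partial>M) < e / 4"
      using LIMSEQ_D[OF sub, of "e / 4"] e by auto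
    define i where "i = max k0 i0"
    have ri: "r i \<ge> k0"
      using seq_suble[OF r, of i] by (simp add: i_def)
    have "(\<integral>x. (norm (A k x - F x))\<^sup>2 \<partial>M) < e" if k: "k \<ge> k0" for k
    proof -
      have "(norm (A k x - F x))\<^sup>2 \<le> 2 * (norm (A k x - A (r i) x))\<^sup>2 + 2 * (norm (A (r i) x - F x))\<^sup>2" for x
      proof -
        define p q where "p = norm (A k x - A (r i) x)" and "q = norm (A (r i) x - F x)"
        have "(norm (A k x - F x))\<^sup>2 \<le> (p + q)\<^sup>2"
          unfolding p_def q_def using norm_triangle_ineq[of "A k x - A (r i) x" "A (r i) x - F x"]
          by (intro power_mono) auto
        also have "\<dots> \<le> 2 * p\<^sup>2 + 2 * q\<^sup>2"
          using zero_le_power2[of "p - q"] by (simp add: power2_eq_square algebra_simps)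
        finally show ?thesis
          by (simp add: p_def q_def)
      qed
      then have "(\<integral>x. (norm (A k x - F x))\<^sup>2 \<partial>M) \<le>
          (\<integral>x. 2 * (norm (A k x - A (r i) x))\<^sup>2 + 2 * (norm (A (r i) x - F x))\<^sup>2 \<partial>M)"
        using int2[OF meas meas AE_bound AE_bound] int2[OF meas F_meas AE_bound F_bound]
        by (intro integral_mono) auto
      also have "\<dots> = 2 * (\<integral>x. (norm (A k x - A (r i) x))\<^sup>2 \<partial>M) + 2 * (\<integral>x. (norm (A (r i) x - F x))\<^sup>2 \<partial>M)"
        using int2[OF meas meas AE_bound AE_bound] int2[OF meas F_meas AE_bound F_bound] by simp
      also have "\<dots> < e"
        using k0[OF k ri] i0[of i] by (simp add: i_def)
      finally show ?thesis .
    qed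
    then show "\<exists>k0. \<forall>k\<ge>k0. norm ((\<integral>x. (norm (A k x - F x))\<^sup>2 \<partial>M) - 0) < e"
      by auto
  qed
  from tendsto_real_sqrt[OF this]
  have "(\<lambda>k. sqrt (\<integral>x. (norm (A k x - F x))\<^sup>2 \<partial>M)) \<longlonglongrightarrow> 0"
    by simp
  moreover have L2: "G \<in> L2 M" if "G \<in> borel_measurable M" "AE x in M. norm (G x) \<le> K" for G
    using int2[OF that(1) _ that(2), of "\<lambda>_. 0"] that K by (auto simp: L2_def)
  have "A k \<in> L2 M" for k
    by (intro L2 meas AE_bound)
  moreover have "F \<in> L2 M"
    by (intro L2 F_meas F_bound)
  ultimately show ?thesis
    unfolding convergent_in_L2_def by blast
qed

section \<open>The system of commuting transformations\<close>

lemma int_iterate_closed: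
  assumes "bij_betw T (space M) (space M)" "x \<in> space M"
  shows "int_iterate M T n x \<in> space M"
proof -
  have "(U ^^ k) x \<in> space M" if "U ` space M \<subseteq> space M" for U k
    using that assms(2) by (induction k) auto
  moreover have "T ` space M \<subseteq> space M" "inv_into (space M) T ` space M \<subseteq> space M"
    using assms(1) by (auto simp: bij_betw_def inv_into_into)
  ultimately show ?thesis
    by (simp add: int_iterate_def)
qed

lemma int_iterate_succ:
  assumes T: "bij_betw T (space M) (space M)" and x: "x \<in> space M"
  shows "int_iterate M T (n + 1) x = T (int_iterate M T n x)"
proof (cases "n \<ge> 0")
  case True
  then have "nat (n + 1) = Suc (nat n)"
    by simp
  then show ?thesis
    using True by (simp add: int_iterate_def)
next
  case False
  define k where "k = nat (- (n + 1))"
  have k: "nat (- n) = Suc k"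
    using False by (simp add: k_def)
  have eq: "int_iterate M T (n + 1) x = (inv_into (space M) T ^^ k) x"
    using False by (cases "n = - 1") (auto simp: int_iterate_def k_def)
  have "int_iterate M T (n + 1) x \<in> space M"
    using int_iterate_closed[OF T x] .
  then show ?thesis
    using False T unfolding eq by (simp add: int_iterate_def k bij_betw_inv_into_right)
qed

lemma int_iterate_zero: "int_iterate M T 0 x = x"
  by (simp add: int_iterate_def)

lemma int_iterate_pred:
  assumes T: "bij_betw T (space M) (space M)" and x: "x \<in> space M"
  shows "T (int_iterate M T (n - 1) x) = int_iterate M T n x"
  using int_iterate_succ[OF assms, of "n - 1"] by simp

lemma int_iterate_add:
  assumes T: "bij_betw T (space M) (space M)" and x: "x \<in> space M"
  shows "int_iterate M T (m + n) x = int_iterate M T m (int_iterate M T n x)"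
proof (induction m rule: int_induct[where k = 0])
  case base
  show ?case
    by (simp add: int_iterate_zero)
next
  case (step1 m)
  have "int_iterate M T (m + 1 + n) x = T (int_iterate M T (m + n) x)"
    using int_iterate_succ[OF T x, of "m + n"] by (simp add: algebra_simps)
  then show ?case
    by (simp add: step1 int_iterate_succ[OF T int_iterate_closed[OF T x]])
next
  case (step2 m)
  have "T (int_iterate M T (m - 1 + n) x) = int_iterate M T (m + n) x"
    using int_iterate_pred[OF T x, of "m + n"] by (simp add: algebra_simps)
  also have "\<dots> = T (int_iterate M T (m - 1) (int_iterate M T n x))"
    by (simp add: step2 int_iterate_pred[OF T int_iterate_closed[OF T x]])
  finally show ?case
    by (rule inj_onD[OF bij_betw_imp_inj_on[OF T]]) (intro int_iterate_closed[OF T] x)+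
qed

lemma int_iterate_commute:
  assumes T: "bij_betw T (space M) (space M)"
    and U: "\<And>x. x \<in> space M \<Longrightarrow> U x \<in> space M" "\<And>x. x \<in> space M \<Longrightarrow> U (T x) = T (U x)"
    and x: "x \<in> space M"
  shows "U (int_iterate M T m x) = int_iterate M T m (U x)"
proof (induction m rule: int_induct[where k = 0])
  case base
  show ?case
    by (simp add: int_iterate_zero)
next
  case (step1 m)
  then show ?case
    by (simp add: int_iterate_succ[OF T] U int_iterate_closed[OF T] x)
next
  case (step2 m)
  have "T (U (int_iterate M T (m - 1) x)) = U (int_iterate M T m x)"
    using U(2)[OF int_iterate_closed[OF T x]] int_iterate_pred[OF T x] by metis
  also have "\<dots> = T (int_iterate M T (m - 1) (U x))"
    by (simp add: step2 int_iterate_pred[OF T U(1)[OF x]])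
  finally show ?case
    by (rule inj_onD[OF bij_betw_imp_inj_on[OF T]]) (intro int_iterate_closed[OF T] x U(1))+
qed

lemma distr_comp_invariant:
  assumes "S \<in> measurable M M" "R \<in> measurable M M" "distr M M S = M" "distr M M R = M"
  shows "S \<circ> R \<in> measurable M M" "distr M M (S \<circ> R) = M"
  using assms by (auto simp: distr_distr[symmetric])

lemma int_iterate_measure_preserving:
  assumes "invertible_mpt M T"
  shows "int_iterate M T n \<in> measurable M M" "distr M M (int_iterate M T n) = M"
proof -
  have T: "bij_betw T (space M) (space M)" "T \<in> measurable M M" "distr M M T = M"
    and V: "inv_into (space M) T \<in> measurable M M"
    using assms by (auto simp: invertible_mpt_def)
  have "distr M M (inv_into (space M) T) = distr (distr M M T) M (inv_into (space M) T)"
    using T by simp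
  also have "\<dots> = distr M M (inv_into (space M) T \<circ> T)"
    using V T by (intro distr_distr)
  also have "\<dots> = distr M M (\<lambda>x. x)"
    using T by (intro distr_cong) (auto simp: bij_betw_def)
  also have "\<dots> = M"
    by (rule distr_id)
  finally have V': "distr M M (inv_into (space M) T) = M" .
  have "S ^^ k \<in> measurable M M \<and> distr M M (S ^^ k) = M"
    if "S \<in> measurable M M" "distr M M S = M" for S k
  proof (induction k)
    case 0
    show ?case
      by (simp add: id_def distr_id)
  next
    case (Suc k)
    then show ?case
      using distr_comp_invariant[of S M "S ^^ k"] that unfolding funpow.simps by blast
  qed
  then show "int_iterate M T n \<in> measurable M M" "distr M M (int_iterate M T n) = M"
    using T V V' by (auto simp: int_iterate_def)
qed

locale commuting_mpts = prob_space M for M :: "'a measure" +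
  fixes d :: nat and T :: "nat \<Rightarrow> 'a \<Rightarrow> 'a"
  assumes invertible: "i \<in> {1..d} \<Longrightarrow> invertible_mpt M (T i)"
    and commute: "i \<in> {1..d} \<Longrightarrow> j \<in> {1..d} \<Longrightarrow> x \<in> space M \<Longrightarrow> T i (T j x) = T j (T i x)"
begin

abbreviation J :: "(nat \<Rightarrow> int) \<Rightarrow> 'a \<Rightarrow> 'a" where
  "J \<equiv> joint_iterate M d T"

text \<open>
  The joint iterate over an arbitrary list of indices, which makes its properties accessible to
  induction.
\<close>

definition iterate_along :: "nat list \<Rightarrow> (nat \<Rightarrow> int) \<Rightarrow> 'a \<Rightarrow> 'a" where
  "iterate_along is m = foldr (\<lambda>i S. int_iterate M (T i) (m i) \<circ> S) is id"

lemma iterate_along_simps: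
  "iterate_along [] m x = x"
  "iterate_along (i # is) m x = int_iterate M (T i) (m i) (iterate_along is m x)"
  by (simp_all add: iterate_along_def)

lemma iterate_along_Cons: "iterate_along (i # is) m = int_iterate M (T i) (m i) \<circ> iterate_along is m"
  by (simp add: iterate_along_def)

lemma bij: "i \<in> {1..d} \<Longrightarrow> bij_betw (T i) (space M) (space M)"
  using invertible by (simp add: invertible_mpt_def)

lemma iterate_along_closed: "set is \<subseteq> {1..d} \<Longrightarrow> x \<in> space M \<Longrightarrow> iterate_along is m x \<in> space M"
  by (induction "is") (auto simp: iterate_along_simps intro!: int_iterate_closed bij)

lemma iterates_commute:
  assumes "i \<in> {1..d}" "j \<in> {1..d}" "x \<in> space M"
  shows "int_iterate M (T i) m (int_iterate M (T j) n x) = int_iterate M (T j) n (int_iterate M (T i) m x)"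
proof (rule int_iterate_commute[OF bij[OF assms(2)] _ _ assms(3)])
  fix x assume x: "x \<in> space M"
  show "int_iterate M (T i) m x \<in> space M"
    by (intro int_iterate_closed bij assms x)
  have "T j ` space M = space M"
    using bij[OF assms(2)] by (simp add: bij_betw_def)
  then show "int_iterate M (T i) m (T j x) = T j (int_iterate M (T i) m x)"
    using x commute assms by (intro int_iterate_commute[OF bij, symmetric]) auto
qed

lemma iterate_iterate_along_commute:
  assumes "i \<in> {1..d}" "set is \<subseteq> {1..d}" "x \<in> space M"
  shows "int_iterate M (T i) n (iterate_along is m x) = iterate_along is m (int_iterate M (T i) n x)"
  using assms(2)
proof (induction "is")
  case (Cons j "is")
  then show ?case
    using iterates_commute[of i j "iterate_along is m x" n "m j"] assms
    by (simp add: iterate_along_simps iterate_along_closed)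
qed (simp add: iterate_along_simps)

lemma iterate_along_add:
  assumes "set is \<subseteq> {1..d}" "x \<in> space M"
  shows "iterate_along is (m + n) x = iterate_along is m (iterate_along is n x)"
  using assms
proof (induction "is")
  case (Cons i "is")
  then have IH: "iterate_along is (m + n) x = iterate_along is m (iterate_along is n x)"
    by (intro Cons.IH) auto
  have "iterate_along (i # is) (m + n) x =
      int_iterate M (T i) (m i) (int_iterate M (T i) (n i) (iterate_along is m (iterate_along is n x)))"
    using Cons.prems by (simp add: iterate_along_simps IH int_iterate_add[OF bij] iterate_along_closed)
  also have "\<dots> = iterate_along (i # is) m (iterate_along (i # is) n x)"
    using Cons.prems by (simp add: iterate_along_simps iterate_iterate_along_commute iterate_along_closed)
  finally show ?case .
qed (simp add: iterate_along_simps)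

lemma iterate_along_measure_preserving:
  "set is \<subseteq> {1..d} \<Longrightarrow> iterate_along is m \<in> measurable M M \<and> distr M M (iterate_along is m) = M"
proof (induction "is")
  case Nil
  show ?case
    by (simp add: iterate_along_def id_def distr_id)
next
  case (Cons i "is")
  then show ?case
    using distr_comp_invariant[of "int_iterate M (T i) (m i)" M "iterate_along is m"]
      int_iterate_measure_preserving[OF invertible, of i "m i"]
    unfolding iterate_along_Cons by (metis (full_types) Cons.prems insert_subset list.simps(15))
qed

lemma iterate_along_cong: "(\<And>i. i \<in> set is \<Longrightarrow> m i = n i) \<Longrightarrow> iterate_along is m = iterate_along is n"
  unfolding iterate_along_def by (intro foldr_cong) auto

lemma J_iterate_along: "J m = iterate_along [1..<Suc d] m"
  by (simp add: joint_iterate_def iterate_along_def)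

lemma J_cong: "(\<And>i. i \<in> {1..d} \<Longrightarrow> m i = n i) \<Longrightarrow> J m = J n"
  unfolding J_iterate_along by (intro iterate_along_cong) auto

lemma set_indices: "set [1..<Suc d] \<subseteq> {1..d}"
  by auto

lemma J_closed: "x \<in> space M \<Longrightarrow> J m x \<in> space M"
  and J_add: "x \<in> space M \<Longrightarrow> J (m + n) x = J m (J n x)"
  and J_measurable: "J m \<in> measurable M M"
  and J_distr: "distr M M (J m) = M"
  unfolding J_iterate_along
  using iterate_along_closed[OF set_indices] iterate_along_add[OF set_indices]
    iterate_along_measure_preserving[OF set_indices] by auto

lemma J_zero: "J 0 x = x"
proof -
  have "iterate_along is 0 x = x" for "is"
    by (induction "is") (auto simp: iterate_along_simps int_iterate_zero)
  then show ?thesis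
    by (simp add: J_iterate_along)
qed

text \<open>
  The transformations are bijections of \<open>space M\<close> only. Off \<open>space M\<close> the action is the identity on the
  point, so that it is a group action on the whole type.
\<close>

definition act :: "(nat \<Rightarrow> int) \<Rightarrow> (nat \<times> (nat \<Rightarrow> int)) list \<times> 'a \<Rightarrow> (nat \<times> (nat \<Rightarrow> int)) list \<times> 'a" where
  "act m y = (map (\<lambda>(j, n). (j, n + m)) (fst y), if snd y \<in> space M then J m (snd y) else snd y)"

definition copy :: "nat \<Rightarrow> (nat \<Rightarrow> int) \<Rightarrow> (nat \<times> (nat \<Rightarrow> int)) list \<times> 'a \<Rightarrow> (nat \<times> (nat \<Rightarrow> int)) list \<times> 'a" where
  "copy j n y = ((j, n) # fst y, snd y)"

text \<open>
  No measurability in the list is asked for: the states in question integrate over points only, and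
  treat lists by means over finite sets and generalized limits.
\<close>

definition bounded_slicewise :: "((nat \<times> (nat \<Rightarrow> int)) list \<times> 'a \<Rightarrow> complex) set" where
  "bounded_slicewise = {F. (\<forall>l. (\<lambda>x. F (l, x)) \<in> borel_measurable M) \<and> (\<exists>K. \<forall>y. norm (F y) \<le> K)}"

lemma copy_system_bounded_slicewise:
  assumes "\<And>k. finite (B k)" "\<And>k. B k \<noteq> {}"
    "\<And>m. (\<And>i. i \<notin> {1..d} \<Longrightarrow> m i = 0) \<Longrightarrow>
      (\<lambda>k. card ((\<lambda>n. n + m) ` B k - B k) / card (B k)) \<longlonglongrightarrow> 0"
  shows "copy_system {1..d} act bounded_slicewise copy B"
proof
  show "act 0 y = y" for y
    by (auto simp: act_def J_zero prod_eq_iff case_prod_beta)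
  show "act (m + n) y = act m (act n y)" for m n y
    by (auto simp: act_def J_add J_closed add_ac)
  show "\<exists>K. \<forall>y. norm (F y) \<le> K" if "F \<in> bounded_slicewise" for F
    using that by (simp add: bounded_slicewise_def)
  show "(\<lambda>_. c) \<in> bounded_slicewise" for c
    by (auto simp: bounded_slicewise_def)
  show "(\<lambda>y. F y + G y) \<in> bounded_slicewise" if FG: "F \<in> bounded_slicewise" "G \<in> bounded_slicewise" for F G
  proof -
    obtain K L where KL: "\<And>y. norm (F y) \<le> K" "\<And>y. norm (G y) \<le> L"
      using FG by (auto simp: bounded_slicewise_def)
    then have "norm (F y + G y) \<le> K + L" for y
      by (intro norm_triangle_le add_mono)
    then show ?thesis
      using FG by (auto simp: bounded_slicewise_def intro!: borel_measurable_add)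
  qed
  show "(\<lambda>y. F y * G y) \<in> bounded_slicewise" if FG: "F \<in> bounded_slicewise" "G \<in> bounded_slicewise" for F G
  proof -
    obtain K L where KL: "\<And>y. norm (F y) \<le> K" "\<And>y. norm (G y) \<le> L"
      using FG by (auto simp: bounded_slicewise_def)
    then have "norm (F y * G y) \<le> K * L" for y
      unfolding norm_mult by (meson mult_mono norm_ge_zero order_trans)
    then show ?thesis
      using FG by (auto simp: bounded_slicewise_def intro!: borel_measurable_times)
  qed
  show "(\<lambda>y. cnj (F y)) \<in> bounded_slicewise" if "F \<in> bounded_slicewise" for F
  proof -
    have "cnj \<in> borel_measurable borel"
      by (intro borel_measurable_continuous_onI continuous_intros)
    then show ?thesis
      using that by (auto simp: bounded_slicewise_def intro: measurable_compose)
  qed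
  show "(\<lambda>y. F (act m y)) \<in> bounded_slicewise" if "F \<in> bounded_slicewise" for F m
  proof -
    have "(\<lambda>x. F (act m (l, x))) \<in> borel_measurable M" for l
    proof -
      have "(\<lambda>x. F (map (\<lambda>(j, n). (j, n + m)) l, J m x)) \<in> borel_measurable M"
        using that by (intro measurable_compose[OF J_measurable]) (auto simp: bounded_slicewise_def)
      then show ?thesis
        by (subst measurable_cong[where g = "\<lambda>x. F (map (\<lambda>(j, n). (j, n + m)) l, J m x)"])
          (auto simp: act_def)
    qed
    then show ?thesis
      using that unfolding bounded_slicewise_def by blast
  qed
  show "(\<lambda>y. F (copy j n y)) \<in> bounded_slicewise" if "F \<in> bounded_slicewise" for F j n
    using that by (auto simp: bounded_slicewise_def copy_def)
  show "\<exists>F\<in>bounded_slicewise. (\<forall>y. norm (F y) \<le> K) \<and> (\<forall>j n y. F (copy j n y) = \<Phi> j n y)"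
    if \<Phi>: "\<And>j n. \<Phi> j n \<in> bounded_slicewise" and K: "\<And>j n y. norm (\<Phi> j n y) \<le> K" for \<Phi> K
  proof -
    define F where "F y = (case fst y of [] \<Rightarrow> 0 | p # l \<Rightarrow> \<Phi> (fst p) (snd p) (l, snd y))" for y
    have "0 \<le> K"
      using K order_trans norm_ge_zero by blast
    then have bound: "norm (F y) \<le> K" for y
      using K by (auto simp: F_def split: list.split)
    moreover have "(\<lambda>x. F (l, x)) \<in> borel_measurable M" for l
      using \<Phi> by (cases l) (auto simp: F_def bounded_slicewise_def)
    ultimately have "F \<in> bounded_slicewise"
      by (auto simp: bounded_slicewise_def)
    then show ?thesis
      using bound by (intro bexI[of _ F]) (auto simp: F_def copy_def)
  qed
  show "act m (copy j n y) = copy j (n + m) (act m y)" for m j n y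
    by (simp add: act_def copy_def)
qed (use assms in auto)

lemma integrable_bounded_slicewise:
  assumes "F \<in> bounded_slicewise"
  shows "integrable M (\<lambda>x. Re (F (l, x)))"
proof -
  obtain K where "\<And>y. norm (F y) \<le> K"
    using assms by (auto simp: bounded_slicewise_def)
  then have "norm (Re (F y)) \<le> K" for y
    using abs_Re_le_cmod order_trans by (metis real_norm_def)
  moreover have [measurable]: "(\<lambda>x. F (l, x)) \<in> borel_measurable M"
    using assms by (auto simp: bounded_slicewise_def)
  ultimately show ?thesis
    by (intro integrable_const_bound[of _ K]) auto
qed

text \<open>
  The original system sits at the empty list, where no pair has been adjoined yet.
\<close>

definition base_state :: "((nat \<times> (nat \<Rightarrow> int)) list \<times> 'a \<Rightarrow> complex) \<Rightarrow> real" where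
  "base_state F = (\<integral>x. Re (F ([], x)) \<partial>M)"

lemma state_base:
  assumes "copy_system {1..d} act bounded_slicewise copy B"
  shows "copy_system.state {1..d} act bounded_slicewise base_state"
  unfolding copy_system.state_def[OF assms]
proof (intro conjI ballI allI impI)
  fix F G assume "F \<in> bounded_slicewise" "G \<in> bounded_slicewise"
  then show "base_state (\<lambda>y. F y + G y) = base_state F + base_state G"
    by (simp add: base_state_def integrable_bounded_slicewise)
next
  show "base_state (\<lambda>y. c *\<^sub>R F y) = c * base_state F" for F c
    by (simp add: base_state_def)
  show "0 \<le> base_state F" if "\<forall>y. 0 \<le> Re (F y)" for F
    using that by (simp add: base_state_def)
  show "base_state (\<lambda>_. 1) = 1"
    by (simp add: base_state_def prob_space)
next
  fix F and m :: "nat \<Rightarrow> int" assume "F \<in> bounded_slicewise"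
  then have [measurable]: "(\<lambda>x. F ([], x)) \<in> borel_measurable M"
    by (auto simp: bounded_slicewise_def)
  have meas: "(\<lambda>x. Re (F ([], x))) \<in> borel_measurable M"
    by measurable
  have "base_state (\<lambda>y. F (act m y)) = (\<integral>x. Re (F ([], J m x)) \<partial>M)"
    unfolding base_state_def by (intro Bochner_Integration.integral_cong) (auto simp: act_def)
  also have "\<dots> = (\<integral>x. Re (F ([], x)) \<partial>distr M M (J m))"
    by (rule integral_distr[symmetric, OF J_measurable meas])
  finally show "base_state (\<lambda>y. F (act m y)) = base_state F"
    by (simp add: J_distr base_state_def)
qed

end

text \<open>
  A point of the box that is moved out of it by \<open>m\<close> leaves through some coordinate \<open>i\<close>, and then lies in
  one of two slabs of thickness \<open>\<bar>m i\<bar>\<close> at the ends of the \<open>i\<close>-th interval. The slabs make up at most the fraction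
  \<open>2\<bar>m i\<bar> / (b k i - a k i)\<close> of the box. Boxes have the value 0 outside \<open>I\<close>, which makes them
  subsets of a group of functions; this is the reason for the default value.
\<close>

lemma box_Folner:
  fixes a b :: "nat \<Rightarrow> 'i \<Rightarrow> int"
  assumes I: "finite I"
    and ab: "\<And>i k. i \<in> I \<Longrightarrow> a k i < b k i"
    and len: "\<And>i. i \<in> I \<Longrightarrow> filterlim (\<lambda>k. b k i - a k i) at_top sequentially"
    and m: "\<And>i. i \<notin> I \<Longrightarrow> m i = 0"
  defines "B \<equiv> \<lambda>k. PiE_dflt I 0 (\<lambda>i. {a k i..<b k i})"
  shows "(\<lambda>k. card ((\<lambda>n. n + m) ` B k - B k) / card (B k)) \<longlonglongrightarrow> 0"
proof -
  define S where "S k i = {z \<in> {a k i..<b k i}. z + m i \<notin> {a k i..<b k i}}" for k i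
  define V where "V k i = PiE_dflt I 0 (\<lambda>j. if j = i then S k i else {a k j..<b k j})" for k i
  have finS: "finite (S k i)" for k i
    unfolding S_def by (rule finite_subset[of _ "{a k i..<b k i}"]) auto
  have finV: "finite (V k i)" for k i
    unfolding V_def using I finS by (intro finite_PiE_dflt) auto
  have "card ((\<lambda>n. n + m) ` B k - B k) \<le> (\<Sum>i\<in>I. card (V k i))" for k
  proof -
    have "(\<lambda>n. n + m) ` B k - B k \<subseteq> (\<lambda>n. n + m) ` (\<Union>i\<in>I. V k i)"
    proof
      fix y assume "y \<in> (\<lambda>n. n + m) ` B k - B k"
      then obtain n where n: "n \<in> B k" "y = n + m" "n + m \<notin> B k"
        by blast
      then obtain i where "i \<in> I" "n i + m i \<notin> {a k i..<b k i}"
        using m by (auto simp: B_def PiE_dflt_def)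
      then have "n \<in> V k i"
        using n(1) by (auto simp: B_def V_def S_def PiE_dflt_def)
      then show "y \<in> (\<lambda>n. n + m) ` (\<Union>i\<in>I. V k i)"
        using n \<open>i \<in> I\<close> by blast
    qed
    then have "card ((\<lambda>n. n + m) ` B k - B k) \<le> card ((\<lambda>n. n + m) ` (\<Union>i\<in>I. V k i))"
      using I finV by (intro card_mono) auto
    also have "\<dots> \<le> card (\<Union>i\<in>I. V k i)"
      using I finV by (intro card_image_le) auto
    also have "\<dots> \<le> (\<Sum>i\<in>I. card (V k i))"
      using I by (rule card_UN_le)
    finally show ?thesis .
  qed
  then have le: "real (card ((\<lambda>n. n + m) ` B k - B k)) / card (B k) \<le> (\<Sum>i\<in>I. card (V k i) / card (B k))" for k
    unfolding sum_divide_distrib[symmetric] of_nat_sum[symmetric]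
    by (intro divide_right_mono) (simp_all only: of_nat_le_iff of_nat_0_le_iff)
  have ratio: "card (V k i) / card (B k) \<le> 2 * \<bar>m i\<bar> / (b k i - a k i)" if "i \<in> I" for k i
  proof -
    define p where "p = (\<Prod>j\<in>I - {i}. card {a k j..<b k j})"
    have "p > 0"
      unfolding p_def using ab by (intro prod_pos) auto
    moreover have "card (V k i) = card (S k i) * p"
      unfolding V_def p_def using I finS that
      by (subst card_PiE_dflt) (auto simp: prod.remove)
    moreover have "card (B k) = card {a k i..<b k i} * p"
      unfolding B_def p_def using I that by (subst card_PiE_dflt) (auto simp: prod.remove)
    ultimately have "card (V k i) / card (B k) = card (S k i) / card {a k i..<b k i}"
      by simp
    also have "\<dots> = card (S k i) / (b k i - a k i)"
      using ab[OF that, of k] by simp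
    also have "card (S k i) \<le> nat (2 * \<bar>m i\<bar>)"
    proof -
      have "S k i \<subseteq> {b k i - \<bar>m i\<bar>..<b k i} \<union> {a k i..<a k i + \<bar>m i\<bar>}"
        by (auto simp: S_def)
      then have "card (S k i) \<le> card ({b k i - \<bar>m i\<bar>..<b k i} \<union> {a k i..<a k i + \<bar>m i\<bar>})"
        by (intro card_mono) auto
      also have "\<dots> \<le> card {b k i - \<bar>m i\<bar>..<b k i} + card {a k i..<a k i + \<bar>m i\<bar>}"
        by (rule card_Un_le)
      finally show ?thesis
        by simp
    qed
    then have "card (S k i) / (b k i - a k i) \<le> 2 * \<bar>m i\<bar> / (b k i - a k i)"
      using ab[OF that, of k] by (intro divide_right_mono) auto
    finally show ?thesis .
  qed
  have "(\<lambda>k. 2 * \<bar>m i\<bar> / real_of_int (b k i - a k i)) \<longlonglongrightarrow> 0" if "i \<in> I" for i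
    by (intro tendsto_divide_0[OF tendsto_const] filterlim_at_top_imp_at_infinity
        filterlim_compose[OF filterlim_real_of_int_at_top len[OF that]])
  then have lim: "(\<lambda>k. \<Sum>i\<in>I. 2 * \<bar>m i\<bar> / real_of_int (b k i - a k i)) \<longlonglongrightarrow> 0"
    by (intro tendsto_null_sum)
  show ?thesis
  proof (rule Lim_null_comparison[OF always_eventually lim], intro allI)
    fix k
    show "norm (card ((\<lambda>n. n + m) ` B k - B k) / card (B k)) \<le> (\<Sum>i\<in>I. 2 * \<bar>m i\<bar> / real_of_int (b k i - a k i))"
      using order_trans[OF le[of k] sum_mono[OF ratio]] by simp
  qed
qed

section \<open>Convergence of the cubic averages\<close>

definition vertex :: "nat \<Rightarrow> nat set \<Rightarrow> nat \<Rightarrow> int" where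
  "vertex d \<beta> = (\<lambda>i\<in>{1..d}. if i \<in> \<beta> then 1 else 0)"

lemma bij_betw_vertex: "bij_betw (vertex d) (Pow {1..d} - {{}}) (nonzero_vertices d)"
proof (rule bij_betw_byWitness[where f' = "\<lambda>\<epsilon>. {i \<in> {1..d}. \<epsilon> i = 1}"])
  show "\<forall>\<beta>\<in>Pow {1..d} - {{}}. {i \<in> {1..d}. vertex d \<beta> i = 1} = \<beta>"
    by (auto simp: vertex_def split: if_splits)
  have zero_one: "\<epsilon> i = 0 \<or> \<epsilon> i = 1" if "\<epsilon> \<in> {1..d} \<rightarrow>\<^sub>E {0, 1 :: int}" "i \<in> {1..d}" for \<epsilon> i
    using PiE_mem[OF that] by auto
  show "\<forall>\<epsilon>\<in>nonzero_vertices d. vertex d {i \<in> {1..d}. \<epsilon> i = 1} = \<epsilon>"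
  proof
    fix \<epsilon> assume "\<epsilon> \<in> nonzero_vertices d"
    then have \<epsilon>: "\<epsilon> \<in> {1..d} \<rightarrow>\<^sub>E {0, 1}"
      by (simp add: nonzero_vertices_def)
    show "vertex d {i \<in> {1..d}. \<epsilon> i = 1} = \<epsilon>"
    proof
      fix i
      show "vertex d {i \<in> {1..d}. \<epsilon> i = 1} i = \<epsilon> i"
        using zero_one[OF \<epsilon>, of i] PiE_arb[OF \<epsilon>, of i] by (auto simp: vertex_def restrict_def)
    qed
  qed
  have "vertex d \<beta> \<noteq> (\<lambda>i\<in>{1..d}. 0)" if "i \<in> \<beta>" "\<beta> \<subseteq> {1..d}" for \<beta> i
  proof
    assume "vertex d \<beta> = (\<lambda>i\<in>{1..d}. 0)"
    from fun_cong[OF this, of i] that show False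
      by (auto simp: vertex_def restrict_def split: if_splits)
  qed
  moreover have "vertex d \<beta> \<in> {1..d} \<rightarrow>\<^sub>E {0, 1}" for \<beta>
    unfolding vertex_def by (rule PiE_I) (auto simp: restrict_def)
  ultimately have "vertex d \<beta> \<in> nonzero_vertices d" if "\<beta> \<noteq> {}" "\<beta> \<subseteq> {1..d}" for \<beta>
    using that unfolding nonzero_vertices_def by (metis Diff_iff ex_in_conv singletonD)
  then show "vertex d ` (Pow {1..d} - {{}}) \<subseteq> nonzero_vertices d"
    by blast
  have "\<exists>i\<in>{1..d}. \<epsilon> i = 1" if "\<epsilon> \<in> nonzero_vertices d" for \<epsilon>
  proof (rule ccontr)
    assume *: "\<not> (\<exists>i\<in>{1..d}. \<epsilon> i = 1)"
    have \<epsilon>: "\<epsilon> \<in> {1..d} \<rightarrow>\<^sub>E {0, 1}" "\<epsilon> \<noteq> (\<lambda>i\<in>{1..d}. 0)"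
      using that by (auto simp: nonzero_vertices_def)
    have "\<epsilon> i = (\<lambda>i\<in>{1..d}. 0) i" for i
      using zero_one[OF \<epsilon>(1), of i] PiE_arb[OF \<epsilon>(1), of i] * by (auto simp: restrict_def)
    with \<epsilon>(2) show False
      by blast
  qed
  then show "(\<lambda>\<epsilon>. {i \<in> {1..d}. \<epsilon> i = 1}) ` nonzero_vertices d \<subseteq> Pow {1..d} - {{}}"
    by blast
qed

text \<open>
  Multi-indices and vertices that are undefined outside \<open>{1..d}\<close> are exchanged for multi-indices that
  vanish there and for subsets of \<open>{1..d}\<close>.
\<close>

lemma (in commuting_mpts) cubic_average_eq_box_mean:
  fixes f :: "_ \<Rightarrow> 'a \<Rightarrow> complex"
  assumes "x \<in> space M" and ab: "\<And>i. i \<in> {1..d} \<Longrightarrow> a i < b i"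
  shows "(\<Prod>i=1..d. 1 / of_int (b i - a i)) *
     (\<Sum>n\<in>(\<Pi>\<^sub>E i\<in>{1..d}. {a i..<b i}). \<Prod>\<epsilon>\<in>nonzero_vertices d. f \<epsilon> (J (\<lambda>i. n i * \<epsilon> i) x)) =
   (1 / card (PiE_dflt {1..d} 0 (\<lambda>i. {a i..<b i}))) *\<^sub>R
     (\<Sum>n\<in>PiE_dflt {1..d} 0 (\<lambda>i. {a i..<b i}). \<Prod>\<beta>\<in>Pow {1..d} - {{}}. f (vertex d \<beta>) (J (restr \<beta> n) x))"
proof -
  let ?B = "PiE_dflt {1..d} 0 (\<lambda>i. {a i..<b i})"
  have "(\<Prod>\<epsilon>\<in>nonzero_vertices d. f \<epsilon> (J (\<lambda>i. restrict n {1..d} i * \<epsilon> i) x)) =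
      (\<Prod>\<beta>\<in>Pow {1..d} - {{}}. f (vertex d \<beta>) (J (restr \<beta> n) x))" for n
  proof (subst prod.reindex_bij_betw[OF bij_betw_vertex, symmetric], intro prod.cong refl)
    fix \<beta>
    have "J (\<lambda>i. restrict n {1..d} i * vertex d \<beta> i) = J (restr \<beta> n)"
      by (intro J_cong) (auto simp: vertex_def restr_def)
    then show "f (vertex d \<beta>) (J (\<lambda>i. restrict n {1..d} i * vertex d \<beta> i) x) =
        f (vertex d \<beta>) (J (restr \<beta> n) x)"
      by simp
  qed
  moreover have "bij_betw (\<lambda>h. restrict h {1..d}) ?B (\<Pi>\<^sub>E i\<in>{1..d}. {a i..<b i})"
    unfolding bij_betw_def
  proof (intro conjI restrict_PiE_dflt inj_onI)
    fix g h assume gh: "g \<in> ?B" "h \<in> ?B" and eq: "restrict g {1..d} = restrict h {1..d}"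
    show "g = h"
    proof
      fix i show "g i = h i"
        using fun_cong[OF eq, of i] gh by (cases "i \<in> {1..d}") (auto simp: PiE_dflt_def)
    qed
  qed
  ultimately have "(\<Sum>n\<in>(\<Pi>\<^sub>E i\<in>{1..d}. {a i..<b i}). \<Prod>\<epsilon>\<in>nonzero_vertices d. f \<epsilon> (J (\<lambda>i. n i * \<epsilon> i) x)) =
      (\<Sum>n\<in>?B. \<Prod>\<beta>\<in>Pow {1..d} - {{}}. f (vertex d \<beta>) (J (restr \<beta> n) x))"
    by (subst sum.reindex_bij_betw[symmetric]) auto
  moreover have "(\<Prod>i=1..d. 1 / of_int (b i - a i)) = (of_real (1 / card ?B) :: complex)"
  proof -
    have "real (card ?B) = (\<Prod>i=1..d. of_int (b i - a i))"
      using ab by (subst card_PiE_dflt) (auto intro!: prod.cong simp: less_imp_le)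
    then show ?thesis
      by (simp add: prod_dividef)
  qed
  ultimately show ?thesis
    by (simp add: scaleR_conv_of_real)
qed

theorem theorem1p1:
  fixes M :: "'a measure" and d :: nat
    and T :: "nat \<Rightarrow> 'a \<Rightarrow> 'a"
    and f :: "(nat \<Rightarrow> int) \<Rightarrow> 'a \<Rightarrow> complex"
    and a b :: "nat \<Rightarrow> nat \<Rightarrow> int"
  assumes "d \<ge> 1"
    and "prob_space M"
    and "\<And>i. i \<in> {1..d} \<Longrightarrow> invertible_mpt M (T i)"
    and "\<And>i j x. i \<in> {1..d} \<Longrightarrow> j \<in> {1..d} \<Longrightarrow> x \<in> space M \<Longrightarrow> T i (T j x) = T j (T i x)"
    and "\<And>\<epsilon>. \<epsilon> \<in> nonzero_vertices d \<Longrightarrow> f \<epsilon> \<in> borel_measurable M"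
    and "\<And>\<epsilon>. \<epsilon> \<in> nonzero_vertices d \<Longrightarrow> bounded (f \<epsilon> ` space M)"
    and "\<And>i k. i \<in> {1..d} \<Longrightarrow> a i k < b i k"
    and "\<And>i. i \<in> {1..d} \<Longrightarrow> filterlim (\<lambda>k. b i k - a i k) at_top sequentially"
  shows "convergent_in_L2 M (\<lambda>k. cubic_average M d T f (\<lambda>i. a i k) (\<lambda>i. b i k))"
proof -
  interpret prob_space M
    by (rule assms)
  interpret commuting_mpts M d T
    by unfold_locales (use assms(3,4) in auto)
  define B where "B k = PiE_dflt {1..d} 0 (\<lambda>i. {a i k..<b i k})" for k
  have "finite (B k)" "B k \<noteq> {}" for k
    using assms(7) by (auto simp: B_def linorder_not_less intro!: finite_PiE_dflt)
  moreover have "(\<lambda>k. card ((\<lambda>n. n + m) ` B k - B k) / card (B k)) \<longlonglongrightarrow> 0"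
    if "\<And>i. i \<notin> {1..d} \<Longrightarrow> m i = 0" for m
    unfolding B_def using assms(7,8) that by (intro box_Folner) auto
  ultimately have sys: "copy_system {1..d} act bounded_slicewise copy B"
    by (rule copy_system_bounded_slicewise)
  interpret cs: copy_system "{1..d}" act bounded_slicewise copy B
    by (rule sys)
  have base: "cs.state base_state"
    by (rule state_base[OF sys])
  define F where "F \<beta> y = (if \<beta> = {} \<or> snd y \<notin> space M then 1 else f (vertex d \<beta>) (snd y))" for \<beta> and y :: "(nat \<times> (nat \<Rightarrow> int)) list \<times> 'a"
  define U where "U k x = cs.cube_avg (Pow {1..d}) F k ([], x)" for k x
  have vert: "vertex d \<beta> \<in> nonzero_vertices d" if "\<beta> \<subseteq> {1..d}" "\<beta> \<noteq> {}" for \<beta>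
    using bij_betw_vertex that by (auto simp: bij_betw_def)
  have F: "F \<beta> \<in> bounded_slicewise" if \<beta>: "\<beta> \<in> Pow {1..d}" for \<beta>
  proof (cases "\<beta> = {}")
    case True
    then show ?thesis
      by (simp add: F_def[abs_def] cs.A_const)
  next
    case False
    then have v: "vertex d \<beta> \<in> nonzero_vertices d"
      using vert \<beta> by blast
    obtain K where K: "\<And>x. x \<in> space M \<Longrightarrow> norm (f (vertex d \<beta>) x) \<le> K"
      using assms(6)[OF v] by (auto simp: bounded_iff)
    then have "norm (F \<beta> y) \<le> max 1 K" for y
      by (auto simp: F_def le_max_iff_disj)
    moreover have "(\<lambda>x. F \<beta> (l, x)) \<in> borel_measurable M" for l
      using assms(5)[OF v] False
      by (subst measurable_cong[where g = "f (vertex d \<beta>)"]) (auto simp: F_def)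
    ultimately show ?thesis
      unfolding bounded_slicewise_def by blast
  qed
  have avg: "cubic_average M d T f (\<lambda>i. a i k) (\<lambda>i. b i k) x = U k x" if x: "x \<in> space M" for k x
  proof -
    have "(\<Prod>\<beta>\<in>Pow {1..d}. F \<beta> (act (restr \<beta> n) ([], x))) =
        (\<Prod>\<beta>\<in>Pow {1..d} - {{}}. f (vertex d \<beta>) (J (restr \<beta> n) x))" for n
      using x by (subst prod.remove[of _ "{}"]) (auto simp: F_def act_def J_closed intro!: prod.cong)
    then show ?thesis
      unfolding U_def cs.cube_avg_def cs.mean_def cubic_average_def
      using cubic_average_eq_box_mean[OF x, of "\<lambda>i. a i k" "\<lambda>i. b i k" f] assms(7) by (simp add: B_def)
  qed
  have cube_avg: "cs.cube_avg (Pow {1..d}) F k \<in> bounded_slicewise" for k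
    using F by (intro cs.cube_avg_in_A) auto
  then have U_meas: "U k \<in> borel_measurable M" for k
    by (auto simp: U_def[abs_def] bounded_slicewise_def)
  have "cs.cauchy base_state (cs.cube_avg (Pow {1..d}) F)"
    using F base by (intro cs.cube_avg_cauchy) auto
  moreover have "cs.sqnorm base_state (\<lambda>y. cs.cube_avg (Pow {1..d}) F k y - cs.cube_avg (Pow {1..d}) F l y) =
      (\<integral>x. (norm (U k x - U l x))\<^sup>2 \<partial>M)" for k l
    unfolding cs.sqnorm_def base_state_def cs.Re_mult_cnj U_def ..
  ultimately have U_cauchy: "\<exists>k0. \<forall>k\<ge>k0. \<forall>l\<ge>k0. (\<integral>x. (norm (U k x - U l x))\<^sup>2 \<partial>M) < e" if "e > 0" for e
    using that by (simp add: cs.cauchy_def)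
  obtain K where K: "\<And>k x. norm (U k x) \<le> K"
    using cs.cube_avg_bounded[of "Pow {1..d}" F] F unfolding U_def by blast
  have avg_eq: "(\<integral>x. (norm (cubic_average M d T f (\<lambda>i. a i k) (\<lambda>i. b i k) x -
        cubic_average M d T f (\<lambda>i. a i l) (\<lambda>i. b i l) x))\<^sup>2 \<partial>M) =
      (\<integral>x. (norm (U k x - U l x))\<^sup>2 \<partial>M)" for k l
    by (intro Bochner_Integration.integral_cong) (simp_all add: avg)
  show ?thesis
  proof (rule convergent_in_L2_Cauchy)
    show "cubic_average M d T f (\<lambda>i. a i k) (\<lambda>i. b i k) \<in> borel_measurable M" for k
      using U_meas by (subst measurable_cong[OF avg])
    show "norm (cubic_average M d T f (\<lambda>i. a i k) (\<lambda>i. b i k) x) \<le> K" if "x \<in> space M" for k x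
      using K by (simp add: avg[OF that])
    show "\<exists>k0. \<forall>k\<ge>k0. \<forall>l\<ge>k0. (\<integral>x. (norm (cubic_average M d T f (\<lambda>i. a i k) (\<lambda>i. b i k) x -
        cubic_average M d T f (\<lambda>i. a i l) (\<lambda>i. b i l) x))\<^sup>2 \<partial>M) < e" if "e > 0" for e
      unfolding avg_eq by (rule U_cauchy[OF that])
  qed
qed

end
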